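(* Let $f=A+\cdots$ be a formal vector field on $\mathbb C^n$ in Poincaré–Dulac normal form, with $A_s=\mathrm{diag}(\lambda_1,\ldots,\lambda_n)$. Assume that the $I(A_s)$-module $I_{\mathrm{div}A_s}(A_s)$ is generated by $\sigma:=x_1\cdots x_n$, and moreover that $I(A_s)$ admits an algebraically independent generator system of monomials $\phi_1,\ldots,\phi_r$, satisfying $$X_{Q_j}(\phi_i)=m_{ij}\phi_i\quad\text{with nonnegative integers }m_{ij},\quad 1\le i\le r,\ 1\le j\le n,$$ where $Q_j(x)=x_je_j$. (a) Then $f=A+\sum_{j=1}^n\eta_jQ_j$ with $\eta_j(x)=\widehat\eta_j(\phi_1(x),\ldots,\phi_r(x))$, $\widehat\eta_j\in\mathbb C[[y_1,\ldots,y_r]]$, $1\le j\le n$, and the reduced vector field has the form $$\widehat f(y)=\begin{pmatrix}y_1\sum_j m_{1j}\widehat\eta_j\\ \vdots\\ y_r\sum_j m_{rj}\widehat\eta_j\end{pmatrix}.$$ (b) If $\psi$ is a formal inverse Jacobi multiplier for $f$, thus $\psi=\sigma\cdot\rho$ with $\rho(x)=\widehat\rho(\phi_1(x),\ldots,\phi_r(x))$, $\widehat\rho\in\mathbb C[[y_1,\ldots,y_r]]$, then $\widetilde\psi:=y_1\cdots y_r\cdot\widehat\rho$ is an inverse Jacobi multiplier for the reduced vector field $\widehat f$. (c) Let the quadratic part of $\widehat f$ be given as $$\widehat f_2=\begin{pmatrix}y_1\sum_j\nu_{1j}y_j\\ \vdots\\ y_r\sum_j\nu_{rj}y_j\end{pmatrix}\quad\text{with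 }\nu_{ij}\in\mathbb C.$$ Then: - Whenever $r\ge3$, $\widehat f_2$ admits no inverse Jacobi multiplier for $(\nu_{ij})$ in a subset of $\mathbb C^{r\times r}$ of full measure. Consequently the reduced vector field admits no inverse Jacobi multiplier whenever $\widehat f_2$ is of this form (i.e. has coefficients in this subset). - In case $r=2$ there exists a subset of $\mathbb C^{2\times2}$ of full measure such that $\widehat f_2$ with coefficients in this subset admits a unique inverse Jacobi multiplier (up to scalar multiples). Moreover for every $(\nu_{ij}^* )$ in this set there is a subset of full measure in the coefficient space of $\widehat f_3$ such that $\widehat f_2+\widehat f_3+\cdots$ does not admit an inverse Jacobi multiplier for the coefficients of $\widehat f_3$ in this latter set.
   Context: Formal vector fields on $\mathbb C^n$ are elements of $\mathbb C[[x_1,\ldots,x_n]]^n$; a matrix $B$ is identified with the linear vector field $x\mapsto Bx$; $e_j$ is the $j$-th standard basis vector. $[g,h](x)=Dh(x)g(x)-Dg(x)h(x)$ and $X_g(\phi)(x)=D\phi(x)g(x)$. $f(x)=Ax+\text{h.o.t.}$ is in Poincaré–Dulac normal form if $[A_s,f]=0$, with $A_s$ the semisimple part of $A$. $$I(A_s)=\{\phi\in\mathbb C[x_1,\ldots,x_n];\ X_{A_s}(\phi)=0\},\qquad I_\alpha(A_s)=\{\psi\in\mathbb C[x_1,\ldots,x_n];\ X_{A_s}(\psi)=\alpha\psi\}\quad(\alpha\in\mathbb C),$$ and $\mathrm{div}\,f=\mathrm{tr}\,Df$, so $\mathrm{div}\,A_s=\sum\lambda_i$. A formal inverse Jacobi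 multiplier of a vector field $f$ is a formal power series $\psi\neq0$ with $X_f(\psi)=\mathrm{div}f\cdot\psi$. Reduced vector field: $\widehat f\in\mathbb C[[y_1,\ldots,y_r]]^r$ is determined by $D\Phi(x)f(x)=\widehat f(\Phi(x))$ where $\Phi=(\phi_1,\ldots,\phi_r)^\tau$; $\widehat f_k$ denotes its homogeneous part of degree $k$ (the lowest possible degree is $2$, and the $i$-th component of $\widehat f_k$ is $y_i$ times a homogeneous polynomial of degree $k-1$; the coefficient space of $\widehat f_3$ refers to vector fields of this form). A subset has full measure if its complement has measure zero. *)

theory Defs
  imports "HOL-Analysis.Analysis" "HOL-Library.Function_Algebras" "HOL-Library.Uprod"
begin

section \<open>Formal power series in finitely many variables\<close>

text \<open>
  \<open>'n mfps\<close> is the ring of formal power series over the complex numbers in variables indexed by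
  the finite type \<open>'n\<close>; a series is given by its coefficients at the multi-indices \<open>'n \<Rightarrow> nat\<close>.
\<close>

typedef 'n mfps = "UNIV :: (('n \<Rightarrow> nat) \<Rightarrow> complex) set"
  morphisms mfps_nth Abs_mfps ..

setup_lifting type_definition_mfps

lemma mfps_eqI: "(\<And>k. mfps_nth a k = mfps_nth b k) \<Longrightarrow> a = b"
  by transfer auto

lemma finite_multi_index_splits:
  fixes k :: "'n::finite \<Rightarrow> nat"
  shows "finite {(i, j). i + j = k}"
proof -
  have "{..k} = PiE UNIV (\<lambda>v. {..k v})"
    by (simp add: set_eq_iff PiE_UNIV_domain le_fun_def Pi_iff)
  then have "finite {..k}"
    by (simp add: finite_PiE)
  moreover have "{(i, j). i + j = k} \<subseteq> {..k} \<times> {..k}"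
    by (clarsimp simp: le_fun_def)
  ultimately show ?thesis
    by (blast intro: finite_subset finite_cartesian_product)
qed

instantiation mfps :: (type) ab_group_add
begin
lift_definition zero_mfps :: "'a mfps" is "\<lambda>_. 0" .
lift_definition plus_mfps :: "'a mfps \<Rightarrow> 'a mfps \<Rightarrow> 'a mfps" is "\<lambda>a b k. a k + b k" .
lift_definition minus_mfps :: "'a mfps \<Rightarrow> 'a mfps \<Rightarrow> 'a mfps" is "\<lambda>a b k. a k - b k" .
lift_definition uminus_mfps :: "'a mfps \<Rightarrow> 'a mfps" is "\<lambda>a k. - a k" .
instance
  by standard (transfer; simp add: fun_eq_iff algebra_simps)+
end

instantiation mfps :: (finite) comm_ring_1
begin

lift_definition one_mfps :: "'a mfps" is "\<lambda>k. if k = 0 then 1 else 0" .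

lift_definition times_mfps :: "'a mfps \<Rightarrow> 'a mfps \<Rightarrow> 'a mfps"
  is "\<lambda>a b k. \<Sum>(i, j)\<in>{(i, j). i + j = k}. a i * b j" .

instance
proof
  fix a b c :: "'a mfps"
  show "a * b * c = a * (b * c)"
  proof (transfer, rule ext)
    fix a b c :: "('a \<Rightarrow> nat) \<Rightarrow> complex" and k :: "'a \<Rightarrow> nat"
    let ?S = "\<lambda>k :: 'a \<Rightarrow> nat. {(i, j). i + j = k}"
    have fin: "finite (?S k)" for k
      by (rule finite_multi_index_splits)
    have "(\<Sum>x\<in>?S k. \<Sum>y\<in>?S (fst x). a (fst y) * b (snd y) * c (snd x))
        = (\<Sum>(x, y)\<in>(SIGMA x:?S k. ?S (fst x)). a (fst y) * b (snd y) * c (snd x))"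
      by (rule sum.Sigma) (simp_all add: fin)
    also have "\<dots> = (\<Sum>(x, y)\<in>(SIGMA x:?S k. ?S (snd x)). a (fst x) * (b (fst y) * c (snd y)))"
      by (rule sum.reindex_bij_witness[where
            i = "\<lambda>((i, q), (j, l)). ((i + j, l), (i, j))" and
            j = "\<lambda>((p, l), (i, j)). ((i, j + l), (j, l))"]) (auto simp: add.assoc mult.assoc)
    also have "\<dots> = (\<Sum>x\<in>?S k. \<Sum>y\<in>?S (snd x). a (fst x) * (b (fst y) * c (snd y)))"
      by (rule sum.Sigma[symmetric]) (simp_all add: fin)
    finally show "(\<Sum>(p, l)\<in>?S k. (\<Sum>(i, j)\<in>?S p. a i * b j) * c l)
        = (\<Sum>(i, q)\<in>?S k. a i * (\<Sum>(j, l)\<in>?S q. b j * c l))"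
      by (simp add: case_prod_beta' sum_distrib_right sum_distrib_left)
  qed
  show "a * b = b * a"
  proof (transfer, rule ext)
    fix a b :: "('a \<Rightarrow> nat) \<Rightarrow> complex" and k :: "'a \<Rightarrow> nat"
    show "(\<Sum>(i, j)\<in>{(i, j). i + j = k}. a i * b j) = (\<Sum>(i, j)\<in>{(i, j). i + j = k}. b i * a j)"
      by (rule sum.reindex_bij_witness[where i = prod.swap and j = prod.swap])
        (auto simp only: prod.swap_def fst_conv snd_conv add.commute mult.commute split: prod.splits)
  qed
  show "1 * a = a"
  proof (transfer, rule ext)
    fix a :: "('a \<Rightarrow> nat) \<Rightarrow> complex" and k :: "'a \<Rightarrow> nat"
    have "(\<Sum>(i, j)\<in>{(i, j). i + j = k}. (if i = 0 then 1 else 0) * a j)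
        = (\<Sum>(i, j)\<in>{(0 :: 'a \<Rightarrow> nat, k)}. (if i = 0 then 1 else 0) * a j)"
    proof (rule sum.mono_neutral_right)
      show "finite {(i, j). i + j = k}"
        by (rule finite_multi_index_splits)
      show "{(0, k)} \<subseteq> {(i, j). i + j = k}"
        by simp
      show "\<forall>x\<in>{(i, j). i + j = k} - {(0, k)}. (case x of (i, j) \<Rightarrow> (if i = 0 then 1 else 0) * a j) = 0"
      proof
        fix x assume "x \<in> {(i, j). i + j = k} - {(0, k)}"
        then have "fst x \<noteq> 0"
          by (metis (mono_tags, lifting) DiffD1 DiffD2 add_0 case_prod_beta' insertI1 mem_Collect_eq prod.collapse)
        then show "(case x of (i, j) \<Rightarrow> (if i = 0 then 1 else 0) * a j) = 0"
          by (simp add: case_prod_beta')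
      qed
    qed
    then show "(\<Sum>(i, j)\<in>{(i, j). i + j = k}. (if i = 0 then 1 else 0) * a j) = a k"
      by simp
  qed
  show "(a + b) * c = a * c + b * c"
  proof (transfer, rule ext)
    fix a b c :: "('a \<Rightarrow> nat) \<Rightarrow> complex" and k :: "'a \<Rightarrow> nat"
    show "(\<Sum>(i, j)\<in>{(i, j). i + j = k}. (a i + b i) * c j) =
        (\<Sum>(i, j)\<in>{(i, j). i + j = k}. a i * c j) + (\<Sum>(i, j)\<in>{(i, j). i + j = k}. b i * c j)"
      by (simp only: sum.distrib[symmetric] distrib_right case_prod_beta')
  qed
  have "mfps_nth (0 :: 'a mfps) 0 \<noteq> mfps_nth 1 0"
    by (simp add: zero_mfps.rep_eq one_mfps.rep_eq)
  then show "(0 :: 'a mfps) \<noteq> 1"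
    by auto
qed

end

lift_definition mfps_const :: "complex \<Rightarrow> 'n mfps" is "\<lambda>c k. if k = 0 then c else 0" .

lift_definition mfps_X :: "'n \<Rightarrow> 'n mfps" is "\<lambda>i k. if k = (\<lambda>_. 0)(i := 1) then 1 else 0" .

lift_definition mfps_deriv :: "'n \<Rightarrow> 'n mfps \<Rightarrow> 'n mfps"
  is "\<lambda>i a k. of_nat (Suc (k i)) * a (k(i := Suc (k i)))" .

definition mi_degree :: "('n::finite \<Rightarrow> nat) \<Rightarrow> nat" where
  "mi_degree k = (\<Sum>i\<in>UNIV. k i)"

lift_definition mfps_hom_part :: "nat \<Rightarrow> 'n::finite mfps \<Rightarrow> 'n mfps"
  is "\<lambda>d a k. if mi_degree k = d then a k else 0" .

definition is_mpoly :: "'n mfps \<Rightarrow> bool" where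
  "is_mpoly a \<longleftrightarrow> finite {k. mfps_nth a k \<noteq> 0}"

definition mfps_monom :: "('n::finite \<Rightarrow> nat) \<Rightarrow> 'n mfps" where
  "mfps_monom k = (\<Prod>j\<in>UNIV. mfps_X j ^ k j)"

text \<open>
  Substitution \<open>g(h\<^sub>1, \<dots>, h\<^sub>r)\<close>.  For every \<open>k\<close> the index set of the sum is finite if \<open>g\<close> is a
  polynomial, and also if all \<open>h\<^sub>i\<close> have vanishing constant term; only these cases are meaningful.
\<close>

definition mfps_subst :: "'r::finite mfps \<Rightarrow> ('r \<Rightarrow> 'n::finite mfps) \<Rightarrow> 'n mfps" where
  "mfps_subst g h = Abs_mfps (\<lambda>k.
     \<Sum>p | mfps_nth g p \<noteq> 0 \<and> mfps_nth (\<Prod>i\<in>UNIV. h i ^ p i) k \<noteq> 0.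
       mfps_nth g p * mfps_nth (\<Prod>i\<in>UNIV. h i ^ p i) k)"

section \<open>Formal vector fields\<close>

type_synonym 'n vfield = "'n mfps ^ 'n"

definition linear_vf :: "complex ^ 'n ^ 'n \<Rightarrow> 'n::finite vfield" where
  "linear_vf B = (\<chi> i. \<Sum>j\<in>UNIV. mfps_const (B $ i $ j) * mfps_X j)"

definition vf_hom_part :: "nat \<Rightarrow> 'n::finite vfield \<Rightarrow> 'n vfield" where
  "vf_hom_part d f = (\<chi> i. mfps_hom_part d (f $ i))"

definition lie_deriv :: "'n::finite vfield \<Rightarrow> 'n mfps \<Rightarrow> 'n mfps" where
  "lie_deriv g \<phi> = (\<Sum>j\<in>UNIV. mfps_deriv j \<phi> * g $ j)"

definition lie_bracket :: "'n::finite vfield \<Rightarrow> 'n vfield \<Rightarrow> 'n vfield" where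
  "lie_bracket g h = (\<chi> i. lie_deriv g (h $ i) - lie_deriv h (g $ i))"

definition vf_div :: "'n::finite vfield \<Rightarrow> 'n mfps" where
  "vf_div f = (\<Sum>i\<in>UNIV. mfps_deriv i (f $ i))"

definition inv_jacobi_multiplier :: "'n::finite vfield \<Rightarrow> 'n mfps \<Rightarrow> bool" where
  "inv_jacobi_multiplier f \<psi> \<longleftrightarrow> \<psi> \<noteq> 0 \<and> lie_deriv f \<psi> = vf_div f * \<psi>"

definition Q_vf :: "'n::finite \<Rightarrow> 'n vfield" where
  "Q_vf j = axis j (mfps_X j)"

definition diag_matrix :: "complex ^ 'n \<Rightarrow> complex ^ 'n ^ 'n" where
  "diag_matrix lam = (\<chi> i j. if i = j then lam $ i else 0)"

definition diagonalizable_matrix :: "complex ^ 'n ^ 'n::finite \<Rightarrow> bool" where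
  "diagonalizable_matrix S \<longleftrightarrow>
     (\<exists>(P :: complex ^ 'n ^ 'n) lam. invertible P \<and> S = P ** diag_matrix lam ** matrix_inv P)"

definition nilpotent_matrix :: "complex ^ 'n ^ 'n::finite \<Rightarrow> bool" where
  "nilpotent_matrix N \<longleftrightarrow> (\<exists>k. (((**) N) ^^ k) (mat 1) = 0)"

text \<open>\<open>S\<close> is the semisimple part in the Jordan--Chevalley decomposition of \<open>A\<close>.\<close>

definition semisimple_part :: "complex ^ 'n ^ 'n \<Rightarrow> complex ^ 'n ^ 'n::finite \<Rightarrow> bool" where
  "semisimple_part A S \<longleftrightarrow>
     diagonalizable_matrix S \<and> nilpotent_matrix (A - S) \<and> S ** (A - S) = (A - S) ** S"

text \<open>
  \<open>poincare_dulac A S f\<close>: \<open>f = A + h.o.t.\<close> is in Poincare--Dulac normal form and \<open>S\<close> is the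
  semisimple part of \<open>A\<close>.
\<close>

definition poincare_dulac ::
    "complex ^ 'n ^ 'n \<Rightarrow> complex ^ 'n ^ 'n \<Rightarrow> 'n::finite vfield \<Rightarrow> bool" where
  "poincare_dulac A S f \<longleftrightarrow>
     vf_hom_part 0 f = 0 \<and> vf_hom_part 1 f = linear_vf A \<and>
     semisimple_part A S \<and> lie_bracket (linear_vf S) f = 0"

definition first_integrals :: "complex ^ 'n ^ 'n \<Rightarrow> 'n::finite mfps set" where
  "first_integrals B = {\<phi>. is_mpoly \<phi> \<and> lie_deriv (linear_vf B) \<phi> = 0}"

definition semi_invariants :: "complex ^ 'n ^ 'n \<Rightarrow> complex \<Rightarrow> 'n::finite mfps set" where
  "semi_invariants B \<alpha> = {\<psi>. is_mpoly \<psi> \<and> lie_deriv (linear_vf B) \<psi> = mfps_const \<alpha> * \<psi>}"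

definition alg_independent :: "('r::finite \<Rightarrow> 'n::finite mfps) \<Rightarrow> bool" where
  "alg_independent \<phi> \<longleftrightarrow> (\<forall>p. is_mpoly p \<and> mfps_subst p \<phi> = 0 \<longrightarrow> p = 0)"

definition generated_algebra :: "('r::finite \<Rightarrow> 'n::finite mfps) \<Rightarrow> 'n mfps set" where
  "generated_algebra \<phi> = {mfps_subst p \<phi> | p. is_mpoly p}"

section \<open>The reduced vector field\<close>

locale reducible_normal_form =
  fixes A :: "complex ^ 'n ^ 'n" and f :: "'n::finite vfield" and lam :: "complex ^ 'n"
    and \<phi> :: "'r::finite \<Rightarrow> 'n mfps" and m :: "'r \<Rightarrow> 'n \<Rightarrow> nat"
  assumes normal_form: "poincare_dulac A (diag_matrix lam) f"
    and module_generated: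
      "semi_invariants (diag_matrix lam) (\<Sum>j\<in>UNIV. lam $ j) =
        {\<rho> * (\<Prod>j\<in>UNIV. mfps_X j) | \<rho>. \<rho> \<in> first_integrals (diag_matrix lam)}"
    and monomials: "\<And>i. \<exists>k. \<phi> i = mfps_monom k"
    and independent: "alg_independent \<phi>"
    and generators: "generated_algebra \<phi> = first_integrals (diag_matrix lam)"
    and exponents: "\<And>i j. lie_deriv (Q_vf j) (\<phi> i) = of_nat (m i j) * \<phi> i"

definition reduced_vf :: "'n::finite vfield \<Rightarrow> ('r::finite \<Rightarrow> 'n mfps) \<Rightarrow> 'r vfield \<Rightarrow> bool" where
  "reduced_vf f \<phi> g \<longleftrightarrow> (\<forall>i. lie_deriv f (\<phi> i) = mfps_subst (g $ i) \<phi>)"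

text \<open>Lowest possible degree 2, and the \<open>i\<close>-th component is divisible by \<open>y\<^sub>i\<close>.\<close>

definition reduced_form :: "'r::finite vfield \<Rightarrow> bool" where
  "reduced_form g \<longleftrightarrow> (\<forall>i. \<exists>h. mfps_hom_part 0 h = 0 \<and> g $ i = mfps_X i * h)"

definition quadratic_vf :: "complex ^ 'r ^ 'r \<Rightarrow> 'r::finite vfield" where
  "quadratic_vf \<nu> = (\<chi> i. mfps_X i * (\<Sum>j\<in>UNIV. mfps_const (\<nu> $ i $ j) * mfps_X j))"

text \<open>
  The monomials of degree 2 correspond to the unordered pairs of (not necessarily distinct)
  variables, so \<open>complex ^ 'r uprod ^ 'r\<close> is the coefficient space of the vector fields whose
  \<open>i\<close>-th component is \<open>y\<^sub>i\<close> times a quadratic form.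
\<close>

instance uprod :: (finite) finite
  by standard simp

lift_definition monom2 :: "'r::finite uprod \<Rightarrow> 'r mfps" is "\<lambda>(a, b). mfps_X a * mfps_X b"
  by (auto simp: eq_upair_def mult.commute)

definition cubic_vf :: "complex ^ 'r uprod ^ 'r \<Rightarrow> 'r::finite vfield" where
  "cubic_vf c = (\<chi> i. mfps_X i * (\<Sum>p\<in>UNIV. mfps_const (c $ i $ p) * monom2 p))"

definition full_measure :: "'a::euclidean_space set \<Rightarrow> bool" where
  "full_measure S \<longleftrightarrow> - S \<in> null_sets lebesgue"

end

(*
  A homogeneous weight argument shows that the components of f are x_i times a series in the
  monomials phi. For a vector field with components x_i h_i the multiplier equation for
  psi = sigma rho reads sum h_i theta_i rho = (sum theta_i h_i) rho with the Euler operators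
  theta_i = x_i d/dx_i, and these are compatible with substituting monomials: this gives (b).

  For (c), the lowest order part of a multiplier is a multiplier of the quadratic part. In the
  coefficients a_k its equation is sum_j L_j(K - e_j) a_{K - e_j} = 0 with L_j linear in nu.
  It determines a_k from coefficients with larger exponent k_j, so all a_k vanish outside
  countably many hyperplanes, except for the k = 1 + e_j where L_j(k) is identically zero. The
  coefficients a_{1 + e_j} satisfy one equation for each pair of variables, which for r >= 3
  generically forces them to vanish and for r = 2 leaves a line. In the latter case the equations
  in degree 5 are overdetermined and their solvability is a nontrivial linear condition on the
  cubic coefficients.
*)

theory Submission
  imports Defs
begin

section \<open>Coefficients of products and single monomials\<close>

lemma mfps_nth_mult:
  "mfps_nth (a * b) k = (\<Sum>(i, j)\<in>{(i, j). i + j = k}. mfps_nth a i * mfps_nth b j)"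
  by (simp add: times_mfps.rep_eq)

lemmas mfps_nth_linear [simp] =
  zero_mfps.rep_eq plus_mfps.rep_eq minus_mfps.rep_eq uminus_mfps.rep_eq

lemma mfps_nth_sum [simp]: "mfps_nth (sum g S) k = (\<Sum>x\<in>S. mfps_nth (g x) k)"
  by (induction S rule: infinite_finite_induct) auto

text \<open>Agrees with \<open>mfps_monom\<close> by \<open>mfps_monom_single\<close>; in this form
  multiplication by a monomial is a shift of multi-indices.\<close>

lift_definition mfps_single :: "('n \<Rightarrow> nat) \<Rightarrow> 'n mfps" is "\<lambda>k l. if l = k then 1 else 0" .

lemma mfps_nth_single: "mfps_nth (mfps_single k) l = (if l = k then 1 else 0)"
  by transfer simp

lemma mfps_nth_single_mult:
  fixes k l :: "'n::finite \<Rightarrow> nat"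
  shows "mfps_nth (mfps_single k * a) l = (if k \<le> l then mfps_nth a (l - k) else 0)"
proof (cases "k \<le> l")
  case True
  then have l: "k + (l - k) = l"
    by (auto simp: le_fun_def)
  have "mfps_nth (mfps_single k * a) l =
      (\<Sum>(i, j)\<in>{(k, l - k)}. mfps_nth (mfps_single k) i * mfps_nth a j)"
    unfolding mfps_nth_mult
    by (rule sum.mono_neutral_right) (auto simp: finite_multi_index_splits l mfps_nth_single split: if_splits)
  then show ?thesis
    using True by (simp add: mfps_nth_single)
next
  case False
  have "mfps_nth (mfps_single k * a) l = 0"
    unfolding mfps_nth_mult
    using False by (intro sum.neutral) (auto simp: mfps_nth_single le_fun_def)
  then show ?thesis
    using False by simp
qed

lemma mfps_nth_single_mult_add [simp]:
  fixes k l :: "'n::finite \<Rightarrow> nat"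
  shows "mfps_nth (mfps_single k * a) (k + l) = mfps_nth a l"
  by (simp add: mfps_nth_single_mult le_fun_def)

lemma mfps_single_mult:
  fixes k l :: "'n::finite \<Rightarrow> nat"
  shows "mfps_single k * mfps_single l = mfps_single (k + l)"
proof (rule mfps_eqI)
  fix q
  have "k \<le> q \<and> q - k = l \<longleftrightarrow> q = k + l"
    by (auto simp: le_fun_def fun_eq_iff) (metis le_add_diff_inverse)
  then show "mfps_nth (mfps_single k * mfps_single l) q = mfps_nth (mfps_single (k + l)) q"
    by (auto simp: mfps_nth_single_mult mfps_nth_single)
qed

lemma mfps_single_cancel:
  fixes k :: "'n::finite \<Rightarrow> nat"
  shows "mfps_single k * a = mfps_single k * b \<longleftrightarrow> a = b"
  by (metis mfps_eqI mfps_nth_single_mult_add)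

lemma mfps_single_zero: "mfps_single 0 = (1 :: 'n::finite mfps)"
  by (rule mfps_eqI) (simp add: mfps_nth_single one_mfps.rep_eq)

lemma mfps_single_power:
  fixes k :: "'n::finite \<Rightarrow> nat"
  shows "mfps_single k ^ n = mfps_single (\<lambda>i. n * k i)"
  by (induction n) (auto simp: mfps_single_mult mfps_single_zero[symmetric] zero_fun_def plus_fun_def)

lemma mfps_single_prod:
  fixes g :: "'b \<Rightarrow> 'n::finite \<Rightarrow> nat"
  shows "(\<Prod>x\<in>S. mfps_single (g x)) = mfps_single (\<lambda>i. \<Sum>x\<in>S. g x i)"
  by (induction S rule: infinite_finite_induct)
    (auto simp: mfps_single_mult mfps_single_zero[symmetric] zero_fun_def plus_fun_def)

section \<open>Unit multi-indices and the total degree\<close>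

definition mi_unit :: "'n \<Rightarrow> 'n \<Rightarrow> nat" where
  "mi_unit i = (\<lambda>_. 0)(i := 1)"

lemma mi_unit_apply [simp]: "mi_unit i j = (if i = j then 1 else 0)"
  by (simp add: mi_unit_def)

lemma mi_unit_eq_iff [simp]: "mi_unit i = mi_unit j \<longleftrightarrow> i = j"
  by (metis mi_unit_apply zero_neq_one)

lemma mfps_X_single: "mfps_X i = mfps_single (mi_unit i)"
  by (rule mfps_eqI) (simp add: mfps_nth_single mfps_X.rep_eq mi_unit_def)

lemma mfps_monom_single: "mfps_monom k = mfps_single k"
  by (simp add: mfps_monom_def mfps_X_single mfps_single_power mfps_single_prod if_distrib cong: if_cong)

lemma prod_mfps_X: "(\<Prod>j\<in>UNIV. mfps_X j) = mfps_single (1 :: 'n::finite \<Rightarrow> nat)"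
  by (simp add: mfps_X_single mfps_single_prod one_fun_def)

lemma mfps_nth_const_mult [simp]:
  "mfps_nth (mfps_const c * a) (k :: 'n::finite \<Rightarrow> nat) = c * mfps_nth a k"
proof -
  have "mfps_nth (mfps_const c * a) k =
      (\<Sum>(i, j)\<in>{(0 :: 'n \<Rightarrow> nat, k)}. mfps_nth (mfps_const c) i * mfps_nth a j)"
    unfolding mfps_nth_mult
    by (rule sum.mono_neutral_right)
      (auto simp: finite_multi_index_splits mfps_const.rep_eq split: if_splits)
  then show ?thesis
    by (simp add: mfps_const.rep_eq)
qed

lemma mfps_of_nat_const: "of_nat c = (mfps_const (of_nat c) :: 'n::finite mfps)"
  by (induction c) (auto intro!: mfps_eqI simp: mfps_const.rep_eq one_mfps.rep_eq)

lemma mfps_nth_of_nat_mult [simp]: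
  "mfps_nth (of_nat c * a) (k :: 'n::finite \<Rightarrow> nat) = of_nat c * mfps_nth a k"
  by (simp add: mfps_of_nat_const)

lemma mi_degree_add: "mi_degree (k + l) = mi_degree k + mi_degree l"
  by (simp add: mi_degree_def sum.distrib)

lemma mi_degree_unit [simp]: "mi_degree (mi_unit i) = 1"
  by (simp add: mi_degree_def)

lemma mi_degree_zero_iff [simp]: "mi_degree k = 0 \<longleftrightarrow> k = 0"
  by (auto simp: mi_degree_def fun_eq_iff)

lemma mi_degree_one [simp]: "mi_degree (1 :: 'n::finite \<Rightarrow> nat) = CARD('n)"
  by (simp add: mi_degree_def)

lemma mi_le_split: "k \<le> l \<Longrightarrow> l = k + (l - k)" for k l :: "'n \<Rightarrow> nat"
  by (auto simp: le_fun_def fun_eq_iff)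

lemma mi_unit_split: "0 < k i \<Longrightarrow> k = mi_unit i + (k - mi_unit i)"
  by (auto simp: fun_eq_iff)

lemma mi_degree_eq_one: "mi_degree k = 1 \<Longrightarrow> \<exists>i. k = mi_unit i"
proof -
  assume k: "mi_degree k = 1"
  then have "k \<noteq> 0"
    by (metis mi_degree_zero_iff zero_neq_one)
  then obtain i where "0 < k i"
    by (auto simp: fun_eq_iff)
  then have *: "k = mi_unit i + (k - mi_unit i)"
    by (rule mi_unit_split)
  then have "mi_degree (k - mi_unit i) = 0"
    using k mi_degree_add[of "mi_unit i" "k - mi_unit i"] by simp
  then show ?thesis
    using * by (metis add.right_neutral mi_degree_zero_iff)
qed

section \<open>Euler operators and vector fields whose components are divisible by their own
  variable\<close>

definition mfps_euler :: "'n \<Rightarrow> 'n::finite mfps \<Rightarrow> 'n mfps" where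
  "mfps_euler i a = mfps_X i * mfps_deriv i a"

lemma mfps_nth_euler [simp]: "mfps_nth (mfps_euler i a) k = of_nat (k i) * mfps_nth a k"
proof (cases "k i")
  case 0
  then have "\<not> mi_unit i \<le> k"
    by (auto simp: le_fun_def)
  then show ?thesis
    using 0 by (simp add: mfps_euler_def mfps_X_single mfps_nth_single_mult)
next
  case (Suc n)
  then have "mi_unit i \<le> k" and "(k - mi_unit i)(i := Suc n) = k" and "(k - mi_unit i) i = n"
    by (auto simp: le_fun_def fun_eq_iff)
  then show ?thesis
    using Suc by (simp add: mfps_euler_def mfps_X_single mfps_nth_single_mult mfps_deriv.rep_eq)
qed

text \<open>Every splitting p + q = k has p_i + q_i = k_i, so the eigenvalue k_i distributes over
  the two factors.\<close>

lemma mfps_euler_mult: "mfps_euler i (a * b) = mfps_euler i a * b + a * mfps_euler i b"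
proof (rule mfps_eqI)
  fix k
  have "mfps_nth (mfps_euler i (a * b)) k = (\<Sum>(p, q)\<in>{(p, q). p + q = k}.
      of_nat (p i) * mfps_nth a p * mfps_nth b q + mfps_nth a p * (of_nat (q i) * mfps_nth b q))"
    by (auto simp: mfps_nth_mult sum_distrib_left algebra_simps intro!: sum.cong)
  then show "mfps_nth (mfps_euler i (a * b)) k =
      mfps_nth (mfps_euler i a * b + a * mfps_euler i b) k"
    by (simp add: mfps_nth_mult sum.distrib case_prod_beta')
qed

lemma mfps_euler_single [simp]: "mfps_euler i (mfps_single k) = of_nat (k i) * mfps_single k"
  by (rule mfps_eqI) (simp add: mfps_nth_single)

lemma mfps_deriv_X_mult:
  "mfps_deriv i (mfps_X i * a) = a + mfps_euler i (a :: 'n::finite mfps)"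
proof (rule mfps_eqI)
  fix k :: "'n \<Rightarrow> nat"
  have "k(i := Suc (k i)) = mi_unit i + k"
    by (auto simp: fun_eq_iff)
  then show "mfps_nth (mfps_deriv i (mfps_X i * a)) k = mfps_nth (a + mfps_euler i a) k"
    by (simp add: mfps_deriv.rep_eq mfps_X_single distrib_right)
qed

text \<open>The common shape of the normal form (\<open>f_eq\<close>) and of its reduced field
  (\<open>reduced_vf_iff\<close>). Its Lie derivative is a combination of Euler operators, which act
  diagonally on monomials.\<close>

definition euler_vf :: "('n::finite \<Rightarrow> 'n mfps) \<Rightarrow> 'n vfield" where
  "euler_vf h = (\<chi> i. mfps_X i * h i)"

lemma lie_deriv_euler_vf: "lie_deriv (euler_vf h) \<psi> = (\<Sum>i\<in>UNIV. h i * mfps_euler i \<psi>)"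
  by (simp add: lie_deriv_def euler_vf_def mfps_euler_def mult_ac)

lemma vf_div_euler_vf: "vf_div (euler_vf h) = (\<Sum>i\<in>UNIV. h i + mfps_euler i (h i))"
  by (simp add: vf_div_def euler_vf_def mfps_deriv_X_mult)

text \<open>At a splitting k + p = K the Lie derivative contributes the factor k_i and the
  divergence the factor 1 + p_i, each times the coefficient of h_i at p.\<close>

lemma multiplier_euler_vf_coeff:
  "lie_deriv (euler_vf h) \<psi> = vf_div (euler_vf h) * \<psi> \<longleftrightarrow>
    (\<forall>K. (\<Sum>(k, p)\<in>{(k, p). k + p = K}.
      (\<Sum>i\<in>UNIV. (of_nat (k i) - 1 - of_nat (p i)) * mfps_nth (h i) p) * mfps_nth \<psi> k) = 0)"
proof -
  have "mfps_nth (lie_deriv (euler_vf h) \<psi> - vf_div (euler_vf h) * \<psi>) K =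
      (\<Sum>(k, p)\<in>{(k, p). k + p = K}.
        (\<Sum>i\<in>UNIV. (of_nat (k i) - 1 - of_nat (p i)) * mfps_nth (h i) p) * mfps_nth \<psi> k)" for K
  proof -
    have 1: "mfps_nth (lie_deriv (euler_vf h) \<psi>) K = (\<Sum>(k, p)\<in>{(k, p). k + p = K}.
        (\<Sum>i\<in>UNIV. of_nat (k i) * mfps_nth (h i) p) * mfps_nth \<psi> k)"
    proof -
      have "mfps_nth (lie_deriv (euler_vf h) \<psi>) K = (\<Sum>i\<in>UNIV. mfps_nth (mfps_euler i \<psi> * h i) K)"
        by (simp add: lie_deriv_euler_vf mult.commute)
      also have "\<dots> = (\<Sum>x\<in>{(k, p). k + p = K}. \<Sum>i\<in>UNIV.
          of_nat (fst x i) * mfps_nth (h i) (snd x) * mfps_nth \<psi> (fst x))"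
        unfolding mfps_nth_mult by (subst sum.swap) (simp add: case_prod_beta' mult_ac)
      finally show ?thesis
        by (simp add: case_prod_beta' sum_distrib_right)
    qed
    have 2: "mfps_nth (vf_div (euler_vf h) * \<psi>) K = (\<Sum>(k, p)\<in>{(k, p). k + p = K}.
        (\<Sum>i\<in>UNIV. (1 + of_nat (p i)) * mfps_nth (h i) p) * mfps_nth \<psi> k)"
      by (subst mult.commute)
        (simp add: vf_div_euler_vf mfps_nth_mult algebra_simps case_prod_beta')
    show ?thesis
      by (simp add: 1 2 sum_subtractf case_prod_beta' left_diff_distrib distrib_right sum.distrib
          diff_diff_eq)
  qed
  moreover have "lie_deriv (euler_vf h) \<psi> = vf_div (euler_vf h) * \<psi> \<longleftrightarrow>
      (\<forall>K. mfps_nth (lie_deriv (euler_vf h) \<psi> - vf_div (euler_vf h) * \<psi>) K = 0)"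
    by (metis eq_iff_diff_eq_0 mfps_eqI zero_mfps.rep_eq)
  ultimately show ?thesis
    by presburger
qed

text \<open>The product \<sigma> of all variables is fixed by every Euler operator. Hence both sides
  contain \<sigma> times the sum of the h_i \<rho>, which drops out, and \<sigma> can be cancelled
  from the rest.\<close>

lemma multiplier_euler_vf_monom:
  "lie_deriv (euler_vf h) (mfps_single 1 * \<rho>) = vf_div (euler_vf h) * (mfps_single 1 * \<rho>) \<longleftrightarrow>
    (\<Sum>i\<in>UNIV. h i * mfps_euler i \<rho>) = (\<Sum>i\<in>UNIV. mfps_euler i (h i)) * \<rho>"
proof -
  have "lie_deriv (euler_vf h) (mfps_single 1 * \<rho>) =
      mfps_single 1 * (\<Sum>i\<in>UNIV. h i * \<rho> + h i * mfps_euler i \<rho>)"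
    unfolding lie_deriv_euler_vf sum_distrib_left mfps_euler_mult mfps_euler_single
    by (intro sum.cong refl) (simp add: algebra_simps)
  moreover have "vf_div (euler_vf h) * (mfps_single 1 * \<rho>) =
      mfps_single 1 * (\<Sum>i\<in>UNIV. h i * \<rho> + mfps_euler i (h i) * \<rho>)"
    unfolding vf_div_euler_vf mult.left_commute[of _ "mfps_single 1"] sum_distrib_right
    by (simp add: algebra_simps)
  ultimately show ?thesis
    by (simp add: mfps_single_cancel sum.distrib sum_distrib_right)
qed

section \<open>Substitution of monomials\<close>

text \<open>The exponent of the product of the \<phi>_i^(p_i) when \<phi>_i is the monomial with
  exponent \<open>m i\<close>.\<close>

definition mi_comb :: "('r \<Rightarrow> 'n \<Rightarrow> nat) \<Rightarrow> ('r::finite \<Rightarrow> nat) \<Rightarrow> 'n \<Rightarrow> nat" where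
  "mi_comb m p = (\<lambda>j. \<Sum>i\<in>UNIV. p i * m i j)"

lemma mi_comb_add: "mi_comb m (p + q) = mi_comb m p + mi_comb m q"
  by (simp add: mi_comb_def fun_eq_iff sum.distrib distrib_right)

lemma mi_comb_zero [simp]: "mi_comb m 0 = 0"
  by (simp add: mi_comb_def fun_eq_iff)

lemma mi_comb_unit: "mi_comb m (mi_unit i) = m i"
  by (simp add: mi_comb_def fun_eq_iff if_distribR if_distrib[of "(*)"] cong: if_cong)

lemma prod_single_power:
  "(\<Prod>i\<in>UNIV. mfps_single (m i) ^ p i) = mfps_single (mi_comb m p)"
  by (simp add: mfps_single_power mfps_single_prod mi_comb_def)

lemma mfps_nth_subst_single:
  "mfps_nth (mfps_subst g (\<lambda>i. mfps_single (m i))) k =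
    (\<Sum>p | mfps_nth g p \<noteq> 0 \<and> mi_comb m p = k. mfps_nth g p)"
  by (auto simp: mfps_subst_def Abs_mfps_inverse prod_single_power mfps_nth_single intro!: sum.cong)

lemma mfps_subst_single_single:
  "mfps_subst (mfps_single p) (\<lambda>i. mfps_single (m i)) = mfps_single (mi_comb m p)"
proof (rule mfps_eqI)
  fix k
  have "{q. mfps_nth (mfps_single p) q \<noteq> 0 \<and> mi_comb m q = k} = (if mi_comb m p = k then {p} else {})"
    by (auto simp: mfps_nth_single split: if_splits)
  then show "mfps_nth (mfps_subst (mfps_single p) (\<lambda>i. mfps_single (m i))) k =
      mfps_nth (mfps_single (mi_comb m p)) k"
    by (simp add: mfps_nth_subst_single mfps_nth_single)
qed

lemma is_mpoly_single: "is_mpoly (mfps_single k)"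
  by (simp add: is_mpoly_def mfps_nth_single)

text \<open>Two exponents p and q with the same image would give the nontrivial relation y^p - y^q
  between the monomials.\<close>

lemma inj_mi_comb_of_alg_independent:
  fixes m :: "'r::finite \<Rightarrow> 'n::finite \<Rightarrow> nat"
  assumes "alg_independent (\<lambda>i. mfps_single (m i))"
  shows "inj (mi_comb m)"
proof (rule injI, rule ccontr)
  fix p q :: "'r \<Rightarrow> nat"
  assume eq: "mi_comb m p = mi_comb m q" and "p \<noteq> q"
  let ?g = "mfps_single p - mfps_single q"
  have nz: "mfps_nth ?g l \<noteq> 0 \<longleftrightarrow> l \<in> {p, q}" for l
    using \<open>p \<noteq> q\<close> by (auto simp: mfps_nth_single)
  have "mfps_subst ?g (\<lambda>i. mfps_single (m i)) = 0"
  proof (rule mfps_eqI)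
    fix k
    have "{l. mfps_nth ?g l \<noteq> 0 \<and> mi_comb m l = k} = (if mi_comb m p = k then {p, q} else {})"
      using eq by (auto simp: nz simp del: mfps_nth_linear)
    then show "mfps_nth (mfps_subst ?g (\<lambda>i. mfps_single (m i))) k = mfps_nth 0 k"
      using \<open>p \<noteq> q\<close> by (simp add: mfps_nth_subst_single mfps_nth_single)
  qed
  moreover have "is_mpoly ?g"
    unfolding is_mpoly_def nz by simp
  ultimately have "?g = 0"
    using assms unfolding alg_independent_def by blast
  then have "mfps_nth ?g p = 0"
    by (simp only: zero_mfps.rep_eq)
  then show False
    using nz[of p] by blast
qed

text \<open>Injectivity turns the substitution into a relabelling of coefficients along
  \<open>mi_comb m\<close>. It therefore makes sense for all series, is injective, and respects sums
  and products.\<close>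

locale monomial_subst =
  fixes m :: "'r::finite \<Rightarrow> 'n::finite \<Rightarrow> nat"
  assumes inj: "inj (mi_comb m)"
begin

definition S :: "'r mfps \<Rightarrow> 'n mfps" where
  "S g = mfps_subst g (\<lambda>i. mfps_single (m i))"

lemma mi_comb_eq_iff [simp]: "mi_comb m p = mi_comb m q \<longleftrightarrow> p = q"
  using inj by (auto dest: injD)

lemma mi_comb_eq_zero_iff [simp]: "mi_comb m p = 0 \<longleftrightarrow> p = 0"
  using mi_comb_eq_iff[of p 0] by simp

lemma nth_S [simp]: "mfps_nth (S g) (mi_comb m p) = mfps_nth g p"
proof -
  have "{q. mfps_nth g q \<noteq> 0 \<and> q = p} = (if mfps_nth g p \<noteq> 0 then {p} else {})"
    by auto
  then show ?thesis
    by (simp add: S_def mfps_nth_subst_single)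
qed

lemma nth_S_outside: "k \<notin> range (mi_comb m) \<Longrightarrow> mfps_nth (S g) k = 0"
  unfolding S_def mfps_nth_subst_single by (intro sum.neutral) auto

lemma S_eqI:
  assumes "\<And>p. mfps_nth a (mi_comb m p) = mfps_nth g p"
    and "\<And>k. mfps_nth a k \<noteq> 0 \<Longrightarrow> k \<in> range (mi_comb m)"
  shows "a = S g"
proof (rule mfps_eqI)
  fix k
  show "mfps_nth a k = mfps_nth (S g) k"
    using assms by (cases "k \<in> range (mi_comb m)") (auto simp: nth_S_outside)
qed

lemma S_inject [simp]: "S g = S h \<longleftrightarrow> g = h"
  by (metis mfps_eqI nth_S)

lemma S_add: "S (g + h) = S g + S h"
proof (rule S_eqI[symmetric])
  show "k \<in> range (mi_comb m)" if "mfps_nth (S g + S h) k \<noteq> 0" for k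
    using that by (rule contrapos_np) (simp add: nth_S_outside)
qed simp

lemma S_zero: "S 0 = 0"
  by (rule S_eqI[symmetric]) auto

lemma S_sum: "S (sum g A) = (\<Sum>x\<in>A. S (g x))"
  by (induction A rule: infinite_finite_induct) (auto simp: S_add S_zero)

lemma S_mult: "S (g * h) = S g * S h"
proof (rule S_eqI[symmetric])
  fix p
  let ?E = "mi_comb m"
  have "mfps_nth (S g * S h) (?E p) =
      (\<Sum>(k, l)\<in>map_prod ?E ?E ` {(k, l). k + l = p}. mfps_nth (S g) k * mfps_nth (S h) l)"
    unfolding mfps_nth_mult
  proof (rule sum.mono_neutral_right)
    show "map_prod ?E ?E ` {(k, l). k + l = p} \<subseteq> {(k, l). k + l = ?E p}"
      by (auto simp: mi_comb_add)
    show "\<forall>x\<in>{(k, l). k + l = ?E p} - map_prod ?E ?E ` {(k, l). k + l = p}.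
        (case x of (k, l) \<Rightarrow> mfps_nth (S g) k * mfps_nth (S h) l) = 0"
    proof clarsimp
      fix k l
      assume kl: "k + l = ?E p"
        and notin: "(k, l) \<notin> map_prod ?E ?E ` {(k, l). k + l = p}" and "mfps_nth (S h) l \<noteq> 0"
      then obtain b where b: "l = ?E b"
        using nth_S_outside by blast
      \<comment> \<open>If k were in the range as well, injectivity would give a + b = p, and (k, l)
        would be one of the splittings already counted.\<close>
      have False if "k = ?E a" for a
        using notin kl b that by (auto simp: image_iff mi_comb_add[symmetric])
      then show "mfps_nth (S g) k = 0"
        using nth_S_outside by blast
    qed
  qed (rule finite_multi_index_splits)
  also have "\<dots> = (\<Sum>(k, l)\<in>{(k, l). k + l = p}. mfps_nth g k * mfps_nth h l)"
    by (subst sum.reindex) (auto simp: inj_on_def intro!: sum.cong)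
  finally show "mfps_nth (S g * S h) (?E p) = mfps_nth (g * h) p"
    by (simp add: mfps_nth_mult)
next
  fix k
  assume "mfps_nth (S g * S h) k \<noteq> 0"
  then obtain x where "x \<in> {(a, b). a + b = k}"
    "(case x of (a, b) \<Rightarrow> mfps_nth (S g) a * mfps_nth (S h) b) \<noteq> 0"
    unfolding mfps_nth_mult by (rule sum.not_neutral_contains_not_neutral)
  then obtain a b where ab: "a + b = k" "mfps_nth (S g) a \<noteq> 0" "mfps_nth (S h) b \<noteq> 0"
    by auto
  then have "a \<in> range (mi_comb m)" "b \<in> range (mi_comb m)"
    using nth_S_outside by blast+
  then show "k \<in> range (mi_comb m)"
    using ab(1) by (auto simp: mi_comb_add[symmetric])
qed

text \<open>Chain rule: the j-th exponent of the image of y^p is the sum of the p_i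
  \<open>m i j\<close>.\<close>

lemma euler_S: "mfps_euler j (S g) = S (\<Sum>i\<in>UNIV. of_nat (m i j) * mfps_euler i g)"
proof (rule S_eqI)
  fix p
  show "mfps_nth (mfps_euler j (S g)) (mi_comb m p) =
      mfps_nth (\<Sum>i\<in>UNIV. of_nat (m i j) * mfps_euler i g) p"
    unfolding mfps_nth_sum mfps_nth_of_nat_mult mfps_nth_euler nth_S
    by (simp add: mi_comb_def sum_distrib_left mult_ac)
next
  show "k \<in> range (mi_comb m)" if "mfps_nth (mfps_euler j (S g)) k \<noteq> 0" for k
    using that by (rule contrapos_np) (simp add: nth_S_outside)
qed

lemma S_X: "S (mfps_X i) = mfps_single (m i)"
  by (simp add: S_def mfps_X_single mfps_subst_single_single mi_comb_unit)

text \<open>The core of part (b). Both equations are multiplier equations with the product of the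
  variables already removed; \<open>euler_S\<close> and an exchange of the sums over i and j carry
  one into the other under the injective map \<open>S\<close>.\<close>

lemma multiplier_euler_vf_S:
  assumes "\<And>i. G i = (\<Sum>j\<in>UNIV. of_nat (m i j) * \<xi> j)"
  shows "(\<Sum>j\<in>UNIV. S (\<xi> j) * mfps_euler j (S \<rho>)) = (\<Sum>j\<in>UNIV. mfps_euler j (S (\<xi> j))) * S \<rho> \<longleftrightarrow>
    (\<Sum>i\<in>UNIV. G i * mfps_euler i \<rho>) = (\<Sum>i\<in>UNIV. mfps_euler i (G i)) * \<rho>"
proof -
  have "(\<Sum>j\<in>UNIV. S (\<xi> j) * mfps_euler j (S \<rho>)) = S (\<Sum>i\<in>UNIV. G i * mfps_euler i \<rho>)"
    unfolding euler_S S_mult[symmetric] S_sum[symmetric] S_inject assms sum_distrib_left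
      sum_distrib_right
    by (subst sum.swap) (simp add: mult_ac)
  moreover have "mfps_euler i (G i) = (\<Sum>j\<in>UNIV. of_nat (m i j) * mfps_euler i (\<xi> j))" for i
    by (rule mfps_eqI, unfold mfps_nth_euler assms mfps_nth_sum mfps_nth_of_nat_mult)
      (simp add: sum_distrib_left mult_ac)
  then have "(\<Sum>j\<in>UNIV. mfps_euler j (S (\<xi> j))) = S (\<Sum>i\<in>UNIV. mfps_euler i (G i))"
    unfolding euler_S S_sum[symmetric] by (subst sum.swap) simp
  ultimately show ?thesis
    by (simp add: S_mult[symmetric])
qed

end

section \<open>Normal forms\<close>

lemma mfps_const_zero [simp]: "mfps_const 0 = 0"
  by (rule mfps_eqI) (simp add: mfps_const.rep_eq)

lemma linear_vf_diag: "linear_vf (diag_matrix lam) = euler_vf (\<lambda>i. mfps_const (lam $ i))"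
proof -
  have "(\<Sum>j\<in>UNIV. mfps_const (if i = j then lam $ i else 0) * mfps_X j) =
      (\<Sum>j\<in>UNIV. if i = j then mfps_const (lam $ i) * mfps_X j else 0)" for i
    by (intro sum.cong) auto
  then show ?thesis
    by (simp add: linear_vf_def diag_matrix_def euler_vf_def vec_eq_iff mult.commute)
qed

text \<open>The eigenvalue of the Lie derivative along \<open>diag_matrix lam\<close> on the
  monomial with exponent k, see \<open>nth_lie_deriv_diag\<close>.\<close>

definition mi_weight :: "complex ^ 'n \<Rightarrow> ('n::finite \<Rightarrow> nat) \<Rightarrow> complex" where
  "mi_weight lam k = (\<Sum>j\<in>UNIV. of_nat (k j) * lam $ j)"

lemma mi_weight_add: "mi_weight lam (k + l) = mi_weight lam k + mi_weight lam l"
  by (simp add: mi_weight_def sum.distrib distrib_right)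

lemma mi_weight_one: "mi_weight lam 1 = (\<Sum>j\<in>UNIV. lam $ j)"
  by (simp add: mi_weight_def)

lemma mi_weight_unit: "mi_weight lam (mi_unit i) = lam $ i"
proof -
  have "mi_weight lam (mi_unit i) = (\<Sum>j\<in>UNIV. if i = j then lam $ j else 0)"
    unfolding mi_weight_def by (intro sum.cong) auto
  then show ?thesis
    by simp
qed

lemma nth_lie_deriv_diag:
  "mfps_nth (lie_deriv (linear_vf (diag_matrix lam)) \<psi>) k = mi_weight lam k * mfps_nth \<psi> k"
  unfolding linear_vf_diag lie_deriv_euler_vf mfps_nth_sum mfps_nth_const_mult mfps_nth_euler
  by (simp add: mi_weight_def sum_distrib_left mult_ac)

lemma lie_deriv_Q_vf: "lie_deriv (Q_vf j) \<psi> = mfps_euler j \<psi>"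
proof -
  have "lie_deriv (Q_vf j) \<psi> = (\<Sum>l\<in>UNIV. if l = j then mfps_euler j \<psi> else 0)"
    unfolding lie_deriv_def Q_vf_def
    by (intro sum.cong) (auto simp: axis_def mfps_euler_def mult.commute)
  then show ?thesis
    by simp
qed

lemma lie_deriv_scaled_X: "lie_deriv f (mfps_X i * mfps_const c) = mfps_const c * f $ i"
proof -
  have "mfps_deriv j (mfps_const c * mfps_X i) = (if i = j then mfps_const c else 0)" for j
  proof (rule mfps_eqI)
    fix k
    have "k(j := Suc (k j)) = mi_unit i \<longleftrightarrow> i = j \<and> k = 0"
      by (auto simp: fun_eq_iff split: if_splits)
    then show "mfps_nth (mfps_deriv j (mfps_const c * mfps_X i)) k =
        mfps_nth (if i = j then mfps_const c else 0) k"
      by (simp add: mfps_deriv.rep_eq mfps_X_single mfps_nth_single mfps_const.rep_eq)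
  qed
  then have "lie_deriv f (mfps_const c * mfps_X i) = (\<Sum>j\<in>UNIV. if i = j then mfps_const c * f $ j else 0)"
    unfolding lie_deriv_def by (intro sum.cong) auto
  then show ?thesis
    by (simp add: mult.commute)
qed

text \<open>The diagonal entries of the k-th power are the k-th powers of the entries, and a complex
  number with a vanishing power is zero.\<close>

lemma nilpotent_diag_matrix:
  assumes "nilpotent_matrix (diag_matrix d)"
  shows "d = 0"
proof -
  have "(((**) (diag_matrix d)) ^^ k) (mat 1) $ i $ i = (d $ i) ^ k" for k i
  proof (induction k)
    case (Suc k)
    have "(diag_matrix d ** M) $ i $ i = d $ i * M $ i $ i" for M
      by (simp add: matrix_matrix_mult_def diag_matrix_def if_distrib[of "\<lambda>x. x * _"] cong: if_cong)
    then show ?case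
      using Suc by simp
  qed (simp add: mat_def)
  moreover obtain k where "(((**) (diag_matrix d)) ^^ k) (mat 1) = 0"
    using assms by (auto simp: nilpotent_matrix_def)
  ultimately have "(d $ i) ^ k = 0" for i
    by (metis zero_index)
  then show ?thesis
    by (simp add: vec_eq_iff)
qed

section \<open>Supports of the normal form and of its multipliers, and the reduced field\<close>

context reducible_normal_form
begin

abbreviation "weight \<equiv> mi_weight lam"

text \<open>The eigenvalue of Q_j on a monomial is its j-th exponent, so \<open>m\<close> is the
  matrix of exponents.\<close>

lemma \<phi>_single: "\<phi> i = mfps_single (m i)"
proof -
  obtain k where k: "\<phi> i = mfps_single k"
    using monomials mfps_monom_single by metis
  have "k j = m i j" for j
  proof -
    have "mfps_nth (mfps_euler j (\<phi> i)) k = mfps_nth (of_nat (m i j) * \<phi> i) k"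
      using exponents[of j i] by (simp add: lie_deriv_Q_vf)
    then show ?thesis
      by (simp add: k mfps_nth_single)
  qed
  then show ?thesis
    using k by (metis ext)
qed

lemma \<phi>_eq: "\<phi> = (\<lambda>i. mfps_single (m i))"
  using \<phi>_single by auto

sublocale monomial_subst m
  by standard (use independent in \<open>simp add: \<phi>_eq inj_mi_comb_of_alg_independent\<close>)

lemma subst_S: "mfps_subst g \<phi> = S g"
  by (simp add: S_def \<phi>_eq)

lemma weight_mi_comb: "weight (mi_comb m p) = 0"
proof -
  have "mfps_subst (mfps_single p) \<phi> \<in> first_integrals (diag_matrix lam)"
    using generators is_mpoly_single by (auto simp: generated_algebra_def)
  then have "mfps_nth (lie_deriv (linear_vf (diag_matrix lam)) (mfps_single (mi_comb m p))) (mi_comb m p) = 0"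
    by (simp add: \<phi>_eq mfps_subst_single_single first_integrals_def)
  then show ?thesis
    by (simp only: nth_lie_deriv_diag mfps_nth_single) simp
qed

text \<open>A monomial of weight zero is a first integral, hence a polynomial in the generators, and
  such a polynomial is supported on the range of \<open>mi_comb m\<close>.\<close>

lemma weight_zeroD:
  assumes "weight k = 0"
  shows "k \<in> range (mi_comb m)"
proof -
  have "mfps_single k \<in> first_integrals (diag_matrix lam)"
    using assms by (auto simp: first_integrals_def is_mpoly_single nth_lie_deriv_diag mfps_nth_single
        intro!: mfps_eqI)
  then obtain g where "mfps_single k = S g"
    using generators by (auto simp: generated_algebra_def subst_S)
  then show ?thesis
    using nth_S_outside[of k g] by (metis mfps_nth_single zero_neq_one)
qed

text \<open>The module hypothesis writes such a monomial as \<sigma> times a first integral; what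
  remains after removing \<sigma> has weight zero.\<close>

lemma weight_divD:
  assumes "weight k = (\<Sum>j\<in>UNIV. lam $ j)"
  shows "\<exists>p. k = 1 + mi_comb m p"
proof -
  have "mfps_single k \<in> semi_invariants (diag_matrix lam) (\<Sum>j\<in>UNIV. lam $ j)"
    using assms by (auto simp: semi_invariants_def is_mpoly_single nth_lie_deriv_diag mfps_nth_single
        intro!: mfps_eqI)
  then obtain \<rho> where \<rho>: "\<rho> \<in> first_integrals (diag_matrix lam)"
    and k: "mfps_single k = mfps_single 1 * \<rho>"
    using module_generated by (auto simp: prod_mfps_X mult.commute)
  have "mfps_nth (mfps_single 1 * \<rho>) k \<noteq> 0"
    by (simp add: k[symmetric] mfps_nth_single)
  then have "1 \<le> k" and nz: "mfps_nth \<rho> (k - 1) \<noteq> 0"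
    by (auto simp: mfps_nth_single_mult split: if_splits)
  have "weight (k - 1) * mfps_nth \<rho> (k - 1) = 0"
    using \<rho> by (simp add: first_integrals_def nth_lie_deriv_diag[symmetric])
  then obtain p where "k - 1 = mi_comb m p"
    using nz weight_zeroD by force
  moreover have "k = 1 + (k - 1)"
    using \<open>1 \<le> k\<close> by (rule mi_le_split)
  ultimately show ?thesis
    by metis
qed

text \<open>Commuting with the semisimple part forces weight \<lambda>_i on the i-th component.
  Multiplying by \<sigma> / x_i moves this to the weight of \<sigma>, where the module hypothesis
  applies.\<close>

lemma support_f:
  assumes "mfps_nth (f $ i) k \<noteq> 0"
  shows "\<exists>p. k = mi_unit i + mi_comb m p"
proof -
  have "lie_deriv (linear_vf (diag_matrix lam)) (f $ i) = mfps_const (lam $ i) * f $ i"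
    using normal_form
    by (simp add: poincare_dulac_def lie_bracket_def vec_eq_iff linear_vf_diag euler_vf_def
        lie_deriv_scaled_X)
  then have "weight k * mfps_nth (f $ i) k = lam $ i * mfps_nth (f $ i) k"
    by (metis mfps_nth_const_mult nth_lie_deriv_diag)
  then have w: "weight k = lam $ i"
    using assms by simp
  \<comment> \<open>The exponent of \<sigma> / x_i is 1 - \<open>mi_unit i\<close>; the subtraction
    loses nothing because the i-th entry of 1 is positive.\<close>
  have one: "1 = mi_unit i + (1 - mi_unit i)"
    by (rule mi_unit_split) simp
  have "weight (k + (1 - mi_unit i)) = weight 1"
    by (subst (2) one) (simp add: mi_weight_add w mi_weight_unit)
  then obtain p where "k + (1 - mi_unit i) = 1 + mi_comb m p"
    using weight_divD by (auto simp: mi_weight_one)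
  also have "\<dots> = mi_unit i + mi_comb m p + (1 - mi_unit i)"
    by (subst one) (simp add: ac_simps)
  finally show ?thesis
    by auto
qed

text \<open>The series f_i / x_i in the reduced variables, linear part included: its constant term
  is \<lambda>_i by \<open>\<xi>_zero\<close>.\<close>

definition \<xi> :: "'n \<Rightarrow> 'r mfps" where
  "\<xi> i = Abs_mfps (\<lambda>p. mfps_nth (f $ i) (mi_unit i + mi_comb m p))"

lemma f_eq: "f = euler_vf (\<lambda>i. S (\<xi> i))"
proof -
  have "f $ i = mfps_single (mi_unit i) * S (\<xi> i)" for i
  proof (rule mfps_eqI)
    fix k
    show "mfps_nth (f $ i) k = mfps_nth (mfps_single (mi_unit i) * S (\<xi> i)) k"
    proof (cases "\<exists>p. k = mi_unit i + mi_comb m p")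
      case True
      then show ?thesis
        by (auto simp: \<xi>_def Abs_mfps_inverse)
    next
      case False
      then have "mfps_nth (S (\<xi> i)) (k - mi_unit i) = 0" if "mi_unit i \<le> k"
      proof (intro nth_S_outside notI)
        assume "k - mi_unit i \<in> range (mi_comb m)"
        moreover have "k = mi_unit i + (k - mi_unit i)"
          using that by (rule mi_le_split)
        ultimately show False
          using False by (metis imageE)
      qed
      then show ?thesis
        using False support_f by (auto simp: mfps_nth_single_mult)
    qed
  qed
  then show ?thesis
    by (simp add: euler_vf_def vec_eq_iff mfps_X_single)
qed

lemma matrix_entry: "A $ i $ j = mfps_nth (f $ i) (mi_unit j)"
proof -
  have "vf_hom_part 1 f = linear_vf A"
    using normal_form by (simp add: poincare_dulac_def)
  then have "mfps_hom_part 1 (f $ i) = (\<Sum>l\<in>UNIV. mfps_const (A $ i $ l) * mfps_X l)"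
    by (simp add: vf_hom_part_def linear_vf_def vec_eq_iff)
  then have "mfps_nth (mfps_hom_part 1 (f $ i)) (mi_unit j) = A $ i $ j"
    by (simp add: mfps_X_single mfps_nth_single if_distrib cong: if_cong)
  then show ?thesis
    by (simp add: mfps_hom_part.rep_eq)
qed

text \<open>By \<open>support_f\<close> every term of the i-th component is divisible by x_i, so A
  is diagonal. Then A minus its semisimple part is both diagonal and nilpotent.\<close>

lemma A_eq: "A = diag_matrix lam"
proof -
  have "A $ i $ j = 0" if "i \<noteq> j" for i j
  proof (rule ccontr)
    assume "A $ i $ j \<noteq> 0"
    then obtain p where "mi_unit j = mi_unit i + mi_comb m p"
      using support_f matrix_entry by metis
    then have "mi_unit j i = mi_unit i i + mi_comb m p i"
      by (metis plus_fun_apply)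
    then show False
      using that by simp
  qed
  then have diff: "A - diag_matrix lam = diag_matrix (\<chi> i. A $ i $ i - lam $ i)"
    by (auto simp: diag_matrix_def vec_eq_iff)
  have "nilpotent_matrix (A - diag_matrix lam)"
    using normal_form by (simp add: poincare_dulac_def semisimple_part_def)
  then have "(\<chi> i. A $ i $ i - lam $ i) = 0"
    unfolding diff by (rule nilpotent_diag_matrix)
  then have "A - diag_matrix lam = 0"
    unfolding diff by (simp add: diag_matrix_def vec_eq_iff)
  then show ?thesis
    by simp
qed

lemma \<xi>_zero: "mfps_nth (\<xi> i) 0 = lam $ i"
  using matrix_entry[of i i] by (simp add: \<xi>_def Abs_mfps_inverse A_eq diag_matrix_def)

definition \<eta>hat :: "'n \<Rightarrow> 'r mfps" where
  "\<eta>hat j = \<xi> j - mfps_const (lam $ j)"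

lemma \<eta>hat_zero: "mfps_nth (\<eta>hat j) 0 = 0"
  by (simp add: \<eta>hat_def \<xi>_zero mfps_const.rep_eq)

lemma S_const: "S (mfps_const c) = mfps_const c"
proof (rule S_eqI[symmetric])
  show "k \<in> range (mi_comb m)" if "mfps_nth (mfps_const c) k \<noteq> 0" for k
    using that by (auto simp: mfps_const.rep_eq image_iff split: if_splits intro!: exI[of _ 0])
qed (simp add: mfps_const.rep_eq)

lemma normal_form_expansion: "f = linear_vf A + (\<Sum>j\<in>UNIV. mfps_subst (\<eta>hat j) \<phi> *s Q_vf j)"
proof -
  have "S (\<xi> i) = mfps_const (lam $ i) + S (\<eta>hat i)" for i
    unfolding S_const[symmetric] S_add[symmetric] by (simp add: \<eta>hat_def)
  moreover have "(\<Sum>j\<in>UNIV. S (\<eta>hat j) *s Q_vf j) $ i = mfps_X i * S (\<eta>hat i)" for i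
    by (simp add: Q_vf_def axis_def if_distrib mult.commute cong: if_cong)
  moreover have "f $ i = mfps_X i * S (\<xi> i)" for i
    by (subst f_eq) (simp add: euler_vf_def)
  ultimately show ?thesis
    by (simp add: vec_eq_iff A_eq linear_vf_diag subst_S distrib_left) (simp add: euler_vf_def)
qed

definition reduced :: "'r \<Rightarrow> 'r mfps" where
  "reduced i = (\<Sum>j\<in>UNIV. of_nat (m i j) * \<eta>hat j)"

text \<open>Each \<phi>_i has weight zero, so the sum of the \<open>m i j\<close> \<lambda>_j
  vanishes and the constant terms of the \<open>\<xi> j\<close> cancel.\<close>

lemma reduced_eq: "reduced i = (\<Sum>j\<in>UNIV. of_nat (m i j) * \<xi> j)"
proof (rule mfps_eqI)
  fix k
  have "weight (m i) = 0"
    using weight_mi_comb[of "mi_unit i"] by (simp add: mi_comb_unit)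
  then show "mfps_nth (reduced i) k = mfps_nth (\<Sum>j\<in>UNIV. of_nat (m i j) * \<xi> j) k"
    by (cases "k = 0")
      (simp_all add: reduced_def \<eta>hat_def mfps_const.rep_eq right_diff_distrib sum_subtractf mi_weight_def)
qed

lemma lie_deriv_\<phi>: "lie_deriv f (\<phi> i) = S (mfps_X i * reduced i)"
proof -
  have "lie_deriv f (\<phi> i) = (\<Sum>j\<in>UNIV. S (\<xi> j) * (of_nat (m i j) * mfps_single (m i)))"
    by (subst f_eq) (simp add: lie_deriv_euler_vf \<phi>_single)
  also have "\<dots> = mfps_single (m i) * (\<Sum>j\<in>UNIV. of_nat (m i j) * S (\<xi> j))"
    by (simp add: sum_distrib_left mult_ac)
  also have "(\<Sum>j\<in>UNIV. of_nat (m i j) * S (\<xi> j)) = S (reduced i)"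
    by (simp add: reduced_eq S_sum S_mult mfps_of_nat_const S_const)
  finally show ?thesis
    by (simp add: S_mult S_X)
qed

text \<open>Existence is \<open>lie_deriv_\<phi>\<close>; uniqueness is injectivity of
  \<open>S\<close>.\<close>

lemma reduced_vf_iff: "reduced_vf f \<phi> fhat \<longleftrightarrow> fhat = euler_vf reduced"
  by (auto simp: reduced_vf_def lie_deriv_\<phi> subst_S euler_vf_def vec_eq_iff)

lemma reduced_form_reduced: "reduced_form (euler_vf reduced)"
proof -
  have "mfps_hom_part 0 (reduced i) = 0" for i
    by (rule mfps_eqI) (auto simp: mfps_hom_part.rep_eq reduced_def \<eta>hat_zero)
  then show ?thesis
    by (auto simp: reduced_form_def euler_vf_def)
qed

text \<open>Induction on the degree. In the equation at K a term with p nonzero involves a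
  coefficient of \<psi> of smaller degree but the same weight, since the \<open>S (\<xi> i)\<close>
  are supported in weight zero. The term p = 0 leaves (weight of K - weight of \<sigma>) times the
  coefficient at K.\<close>

lemma multiplier_support:
  assumes "inv_jacobi_multiplier f \<psi>" and "mfps_nth \<psi> K \<noteq> 0"
  shows "weight K = (\<Sum>j\<in>UNIV. lam $ j)"
  using assms(2)
proof (induction "mi_degree K" arbitrary: K rule: less_induct)
  case less
  let ?c = "\<lambda>k p. (\<Sum>i\<in>UNIV. (of_nat (k i) - 1 - of_nat (p i)) * mfps_nth (S (\<xi> i)) p) * mfps_nth \<psi> k"
  show ?case
  proof (rule ccontr)
    assume K: "weight K \<noteq> (\<Sum>j\<in>UNIV. lam $ j)"
    have "?c k p = 0" if kp: "k + p = K" "p \<noteq> 0" for k p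
    proof (cases "p \<in> range (mi_comb m)")
      case False
      then show ?thesis
        by (simp add: nth_S_outside)
    next
      case True
      have "mi_degree k < mi_degree K"
        using mi_degree_add[of k p] kp by (simp add: zero_less_iff_neq_zero)
      moreover have "weight k = weight K"
        using True weight_mi_comb by (auto simp: kp(1)[symmetric] mi_weight_add)
      ultimately have "mfps_nth \<psi> k = 0"
        using less.hyps[of k] K by auto
      then show ?thesis
        by simp
    qed
    then have "\<forall>x\<in>{(k, p). k + p = K} - {(K, 0)}. (case x of (k, p) \<Rightarrow> ?c k p) = 0"
      by fastforce
    then have "(\<Sum>(k, p)\<in>{(k, p). k + p = K}. ?c k p) = (\<Sum>(k, p)\<in>{(K, 0)}. ?c k p)"
      by (intro sum.mono_neutral_right finite_multi_index_splits) auto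
    moreover have "(\<Sum>(k, p)\<in>{(k, p). k + p = K}. ?c k p) = 0"
      using assms(1) multiplier_euler_vf_coeff[of "\<lambda>i. S (\<xi> i)" \<psi>] f_eq
      by (simp add: inv_jacobi_multiplier_def)
    moreover have "mfps_nth (S (\<xi> i)) 0 = lam $ i" for i
      using nth_S[of "\<xi> i" 0] by (simp add: \<xi>_zero)
    ultimately have "(\<Sum>i\<in>UNIV. (of_nat (K i) - 1) * lam $ i) = 0"
      using less.prems by simp
    then show False
      using K by (simp add: mi_weight_def left_diff_distrib sum_subtractf)
  qed
qed

text \<open>By \<open>multiplier_support\<close> and \<open>weight_divD\<close> the support of
  \<psi> lies in 1 plus the range of \<open>mi_comb m\<close>, so \<rho>hat can be read off
  there.\<close>

lemma multiplier_form:
  assumes "inv_jacobi_multiplier f \<psi>"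
  shows "\<exists>\<rho>hat. \<psi> = (\<Prod>j\<in>UNIV. mfps_X j) * mfps_subst \<rho>hat \<phi>"
proof
  let ?\<rho> = "Abs_mfps (\<lambda>p. mfps_nth \<psi> (1 + mi_comb m p))"
  show "\<psi> = (\<Prod>j\<in>UNIV. mfps_X j) * mfps_subst ?\<rho> \<phi>"
    unfolding prod_mfps_X subst_S
  proof (rule mfps_eqI)
    fix k
    show "mfps_nth \<psi> k = mfps_nth (mfps_single 1 * S ?\<rho>) k"
    proof (cases "\<exists>p. k = 1 + mi_comb m p")
      case True
      then show ?thesis
        by (auto simp: Abs_mfps_inverse)
    next
      case False
      have "mfps_nth (S ?\<rho>) (k - 1) = 0" if "1 \<le> k"
      proof (intro nth_S_outside notI)
        assume "k - 1 \<in> range (mi_comb m)"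
        moreover have "k = 1 + (k - 1)"
          using that by (rule mi_le_split)
        ultimately show False
          using False by (metis imageE)
      qed
      moreover have "mfps_nth \<psi> k = 0"
        using False multiplier_support[OF assms] weight_divD by blast
      ultimately show ?thesis
        by (simp add: mfps_nth_single_mult)
    qed
  qed
qed

text \<open>The factor \<sigma> is stripped from the equation for f, the remainder is pulled back
  through \<open>S\<close>, and the product of the reduced variables is attached again.\<close>

lemma multiplier_reduced:
  assumes "inv_jacobi_multiplier f ((\<Prod>j\<in>UNIV. mfps_X j) * mfps_subst \<rho>hat \<phi>)"
  shows "inv_jacobi_multiplier (euler_vf reduced) ((\<Prod>i\<in>UNIV. mfps_X i) * \<rho>hat)"
proof -
  have "(\<Sum>j\<in>UNIV. S (\<xi> j) * mfps_euler j (S \<rho>hat)) =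
      (\<Sum>j\<in>UNIV. mfps_euler j (S (\<xi> j))) * S \<rho>hat"
    using assms f_eq multiplier_euler_vf_monom[of "\<lambda>i. S (\<xi> i)" "S \<rho>hat"]
    by (simp add: inv_jacobi_multiplier_def prod_mfps_X subst_S)
  then have "(\<Sum>i\<in>UNIV. reduced i * mfps_euler i \<rho>hat) =
      (\<Sum>i\<in>UNIV. mfps_euler i (reduced i)) * \<rho>hat"
    using multiplier_euler_vf_S[of reduced \<xi> \<rho>hat] reduced_eq by blast
  moreover have "\<rho>hat \<noteq> 0"
    using assms by (auto simp: inv_jacobi_multiplier_def subst_S S_zero)
  then have "mfps_single 1 * \<rho>hat \<noteq> 0"
    using mfps_single_cancel[of 1 \<rho>hat 0] by simp
  ultimately show ?thesis
    by (simp add: inv_jacobi_multiplier_def prod_mfps_X multiplier_euler_vf_monom)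
qed

lemma reduction:
  "\<exists>(\<eta> :: 'n \<Rightarrow> 'n mfps) (\<eta>h :: 'n \<Rightarrow> 'r mfps).
      (\<forall>j. \<eta> j = mfps_subst (\<eta>h j) \<phi>) \<and>
      f = linear_vf A + (\<Sum>j\<in>UNIV. \<eta> j *s Q_vf j) \<and>
      (\<forall>fhat. reduced_vf f \<phi> fhat \<longleftrightarrow>
        fhat = (\<chi> i. mfps_X i * (\<Sum>j\<in>UNIV. of_nat (m i j) * \<eta>h j)))"
proof (intro exI[of _ "\<lambda>j. mfps_subst (\<eta>hat j) \<phi>"] exI[of _ \<eta>hat] conjI allI refl)
  show "f = linear_vf A + (\<Sum>j\<in>UNIV. mfps_subst (\<eta>hat j) \<phi> *s Q_vf j)"
    by (rule normal_form_expansion)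
  show "reduced_vf f \<phi> fhat \<longleftrightarrow> fhat = (\<chi> i. mfps_X i * (\<Sum>j\<in>UNIV. of_nat (m i j) * \<eta>hat j))" for fhat
    unfolding reduced_vf_iff euler_vf_def reduced_def ..
qed

lemma reduction_form: "reduced_vf f \<phi> fhat \<Longrightarrow> reduced_form fhat"
  by (simp add: reduced_vf_iff reduced_form_reduced)

lemma reduction_multiplier:
  "inv_jacobi_multiplier f ((\<Prod>j\<in>UNIV. mfps_X j) * mfps_subst \<rho>hat \<phi>) \<Longrightarrow> reduced_vf f \<phi> fhat \<Longrightarrow>
    inv_jacobi_multiplier fhat ((\<Prod>i\<in>UNIV. mfps_X i) * \<rho>hat)"
  by (simp add: reduced_vf_iff multiplier_reduced)

end

section \<open>Multipliers and the lowest order terms of a reduced vector field\<close>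

text \<open>\<open>lv_equation \<nu> a K\<close> is the coefficient at \<open>K\<close> of the multiplier equation of
  \<open>quadratic_vf \<nu>\<close> for the series with coefficients \<open>a\<close>.\<close>

definition lv_coeff :: "complex ^ 'r ^ 'r \<Rightarrow> 'r \<Rightarrow> ('r::finite \<Rightarrow> nat) \<Rightarrow> complex" where
  "lv_coeff \<nu> j k = (\<Sum>i\<in>UNIV. (of_nat (k i) - 1) * \<nu> $ i $ j) - \<nu> $ j $ j"

definition lv_equation :: "complex ^ 'r ^ 'r \<Rightarrow> (('r::finite \<Rightarrow> nat) \<Rightarrow> complex) \<Rightarrow> ('r \<Rightarrow> nat) \<Rightarrow> bool" where
  "lv_equation \<nu> a K \<longleftrightarrow>
    (\<Sum>j | 0 < K j. lv_coeff \<nu> j (K - mi_unit j) * a (K - mi_unit j)) = 0"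

text \<open>The excluded \<open>lv_coeff \<nu> j (1 + mi_unit j)\<close> is zero for every \<open>\<nu>\<close>.\<close>

definition lv_generic :: "complex ^ 'r ^ 'r::finite \<Rightarrow> bool" where
  "lv_generic \<nu> \<longleftrightarrow> (\<forall>j k. k \<noteq> 1 + mi_unit j \<longrightarrow> lv_coeff \<nu> j k \<noteq> 0)"

lemma lv_coeff_one_unit: "lv_coeff \<nu> j (1 + mi_unit i) = \<nu> $ i $ j - \<nu> $ j $ j"
  by (simp add: lv_coeff_def if_distrib[of "\<lambda>x. x * _"] if_distrib[of of_nat] cong: if_cong)

lemma lv_genericD: "lv_generic \<nu> \<Longrightarrow> i \<noteq> j \<Longrightarrow> lv_coeff \<nu> j (1 + mi_unit i) \<noteq> 0"
  by (simp add: lv_generic_def)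

lemma mi_degree_mono_apply: "k j \<le> mi_degree k"
  unfolding mi_degree_def by (rule member_le_sum) auto

text \<open>Only p of degree one survives. The assumption \<open>high\<close> covers two uses: the
  h_i are linear forms, or a vanishes in low degrees.\<close>

lemma sum_splits_degree_one:
  assumes zero: "\<And>i. mfps_nth (h i) 0 = 0"
    and one: "\<And>i j. mfps_nth (h i) (mi_unit j) = \<nu> $ i $ j"
    and high: "\<And>k p. k + p = K \<Longrightarrow> 2 \<le> mi_degree p \<Longrightarrow>
      (\<Sum>i\<in>UNIV. (of_nat (k i) - 1 - of_nat (p i)) * mfps_nth (h i) p) * a k = 0"
  shows "(\<Sum>(k, p)\<in>{(k, p). k + p = K}.
      (\<Sum>i\<in>UNIV. (of_nat (k i) - 1 - of_nat (p i)) * mfps_nth (h i) p) * a k) =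
    (\<Sum>j | 0 < K j. lv_coeff \<nu> j (K - mi_unit j) * a (K - mi_unit j))"
proof -
  let ?c = "\<lambda>k p. (\<Sum>i\<in>UNIV. (of_nat (k i) - 1 - of_nat (p i)) * mfps_nth (h i) p) * a k"
  let ?g = "\<lambda>j. (K - mi_unit j, mi_unit j)"
  have "(\<Sum>(k, p)\<in>{(k, p). k + p = K}. ?c k p) = (\<Sum>(k, p)\<in>?g ` {j. 0 < K j}. ?c k p)"
  proof (rule sum.mono_neutral_right)
    show "?g ` {j. 0 < K j} \<subseteq> {(k, p). k + p = K}"
      using mi_unit_split[of K] by (auto simp: add.commute)
    show "\<forall>x\<in>{(k, p). k + p = K} - ?g ` {j. 0 < K j}. (case x of (k, p) \<Rightarrow> ?c k p) = 0"
    proof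
      fix x
      assume *: "x \<in> {(k, p). k + p = K} - ?g ` {j. 0 < K j}"
      obtain k p where x: "x = (k, p)"
        by (cases x)
      have K: "k + p = K" and notin: "(k, p) \<notin> ?g ` {j. 0 < K j}"
        using * by (simp_all add: x)
      have "p \<noteq> mi_unit j" for j
      proof
        assume p: "p = mi_unit j"
        then have "(k, p) = ?g j" "0 < K j"
          by (auto simp: fun_eq_iff K[symmetric])
        then show False
          using notin by blast
      qed
      then have "mi_degree p \<noteq> 1"
        using mi_degree_eq_one by blast
      then have "p = 0 \<or> 2 \<le> mi_degree p"
        using mi_degree_zero_iff[of p] by linarith
      then have "?c k p = 0"
        using zero high[OF K] by auto
      then show "(case x of (k, p) \<Rightarrow> ?c k p) = 0"
        by (simp add: x)
    qed
  qed (rule finite_multi_index_splits)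
  also have "\<dots> = (\<Sum>j | 0 < K j. ?c (K - mi_unit j) (mi_unit j))"
    by (subst sum.reindex) (auto simp: inj_on_def)
  also have "\<dots> = (\<Sum>j | 0 < K j. lv_coeff \<nu> j (K - mi_unit j) * a (K - mi_unit j))"
  proof (intro sum.cong refl arg_cong2[where f = "(*)"])
    fix j
    have "(\<Sum>i\<in>UNIV. of_nat (mi_unit j i) * \<nu> $ i $ j) = \<nu> $ j $ j"
      by (simp add: if_distrib[of "\<lambda>x. x * _"] if_distrib[of of_nat] cong: if_cong)
    then show "(\<Sum>i\<in>UNIV. (of_nat ((K - mi_unit j) i) - 1 - of_nat (mi_unit j i)) * mfps_nth (h i) (mi_unit j)) =
        lv_coeff \<nu> j (K - mi_unit j)"
      unfolding lv_coeff_def one left_diff_distrib[of "_ - 1"] sum_subtractf by simp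
  qed
  finally show ?thesis .
qed

text \<open>The equation at \<open>k + mi_unit j\<close> expresses the coefficient at \<open>k\<close> by coefficients whose
  \<open>j\<close>-th exponent is larger.\<close>

lemma lv_vanish:
  fixes k :: "'r::finite \<Rightarrow> nat"
  assumes gen: "lv_generic \<nu>" and eqs: "\<And>K. mi_degree K = Suc d \<Longrightarrow> lv_equation \<nu> a K"
    and "mi_degree k = d" and "k \<noteq> 1 + mi_unit j" and "2 \<le> k j \<or> d \<noteq> CARD('r) + 1"
  shows "a k = 0"
  using assms(3-5)
\<comment> \<open>The other neighbours of \<open>?K\<close> have j-th exponent k_j + 1, which is
  bounded by their degree d, so the measure decreases.\<close>
proof (induction "d - k j" arbitrary: k rule: less_induct)
  case less
  let ?K = "k + mi_unit j"
  have deg: "mi_degree ?K = Suc d"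
    using less.prems by (simp add: mi_degree_add)
  have "a (?K - mi_unit i) = 0" if "0 < ?K i" "i \<noteq> j" for i
  proof (rule less.hyps)
    have split: "?K = mi_unit i + (?K - mi_unit i)"
      by (rule mi_unit_split) fact
    have j: "(?K - mi_unit i) j = Suc (k j)"
      using that by simp
    show deg': "mi_degree (?K - mi_unit i) = d"
      using arg_cong[OF split, of mi_degree] deg by (simp add: mi_degree_add)
    then have "Suc (k j) \<le> d"
      using mi_degree_mono_apply[of "?K - mi_unit i" j] j by simp
    then show "d - (?K - mi_unit i) j < d - k j"
      unfolding j by simp
    \<comment> \<open>The exceptional exponent has j-th entry 2 and degree r + 1, so reaching it
      would require k_j = 1 in degree r + 1, which the last assumption excludes.\<close>
    show "?K - mi_unit i \<noteq> 1 + mi_unit j"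
    proof
      assume *: "?K - mi_unit i = 1 + mi_unit j"
      then have "d = CARD('r) + 1"
        using deg' by (simp add: mi_degree_add)
      moreover have "k j = 1"
        using j arg_cong[OF *, of "\<lambda>f. f j"] by simp
      ultimately show False
        using less.prems by simp
    qed
    show "2 \<le> (?K - mi_unit i) j \<or> d \<noteq> CARD('r) + 1"
      unfolding j using less.prems by auto
  qed
  then have "(\<Sum>i | 0 < ?K i. lv_coeff \<nu> i (?K - mi_unit i) * a (?K - mi_unit i)) =
      (\<Sum>i\<in>{j}. lv_coeff \<nu> i (?K - mi_unit i) * a (?K - mi_unit i))"
    by (intro sum.mono_neutral_right) auto
  then have "lv_coeff \<nu> j k * a k = 0"
    using eqs[OF deg] by (simp add: lv_equation_def)
  then show ?case
    using gen less.prems by (simp add: lv_generic_def)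
qed

text \<open>It remains to choose a direction j for \<open>lv_vanish\<close>: any one will do unless
  the degree is r + 1, where some exponent is at least 2 by the pigeonhole principle.\<close>

lemma lv_vanish_except:
  fixes k :: "'r::finite \<Rightarrow> nat"
  assumes gen: "lv_generic \<nu>" and eqs: "\<And>K. mi_degree K = Suc d \<Longrightarrow> lv_equation \<nu> a K"
    and deg: "mi_degree k = d" and "\<And>j. k \<noteq> 1 + mi_unit j"
  shows "a k = 0"
proof (cases "d = CARD('r) + 1")
  case True
  have "\<exists>j. 2 \<le> k j"
  proof (rule ccontr)
    assume "\<nexists>j. 2 \<le> k j"
    then have "mi_degree k \<le> (\<Sum>j\<in>(UNIV :: 'r set). 1)"
      unfolding mi_degree_def by (intro sum_mono) (metis Suc_1 not_less_eq_eq One_nat_def)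
    then show False
      using True deg by simp
  qed
  then show ?thesis
    using lv_vanish[OF gen eqs deg] assms(4) by blast
qed (use lv_vanish[OF gen eqs deg] assms(4) in blast)

text \<open>This is the equation at 1 + e_i + e_j. Lowering a third variable l gives exponent 0
  there, so that neighbour is not exceptional and its coefficient vanishes.\<close>

lemma lv_pair:
  fixes i j :: "'r::finite"
  assumes gen: "lv_generic \<nu>" and eqs: "\<And>K. mi_degree K = CARD('r) + 2 \<Longrightarrow> lv_equation \<nu> a K"
    and "i \<noteq> j"
  shows "lv_coeff \<nu> i (1 + mi_unit j) * a (1 + mi_unit j) +
    lv_coeff \<nu> j (1 + mi_unit i) * a (1 + mi_unit i) = 0"
proof -
  let ?K = "1 + mi_unit i + mi_unit j"
  have deg: "mi_degree ?K = CARD('r) + 2"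
    by (simp add: mi_degree_add)
  have K: "?K - mi_unit i = 1 + mi_unit j" "?K - mi_unit j = 1 + mi_unit i"
    by (auto simp: fun_eq_iff)
  have "a (?K - mi_unit l) = 0" if l: "l \<noteq> i" "l \<noteq> j" for l
  proof (rule lv_vanish_except[OF gen, where d = "CARD('r) + 1"])
    show "lv_equation \<nu> a K" if "mi_degree K = Suc (CARD('r) + 1)" for K
      using eqs that by simp
    have split: "?K = mi_unit l + (?K - mi_unit l)"
      by (rule mi_unit_split) simp
    show "mi_degree (?K - mi_unit l) = CARD('r) + 1"
      using arg_cong[OF split, of mi_degree] deg by (simp add: mi_degree_add)
    have "(?K - mi_unit l) l = 0"
      using l by simp
    then show "?K - mi_unit l \<noteq> 1 + mi_unit q" for q
      by (metis add_is_0 one_fun_apply one_neq_zero plus_fun_apply)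
  qed
  then have "(\<Sum>l | 0 < ?K l. lv_coeff \<nu> l (?K - mi_unit l) * a (?K - mi_unit l)) =
      (\<Sum>l\<in>{i, j}. lv_coeff \<nu> l (?K - mi_unit l) * a (?K - mi_unit l))"
    by (intro sum.mono_neutral_right) auto
  then show ?thesis
    using eqs[OF deg] \<open>i \<noteq> j\<close> unfolding lv_equation_def by (simp add: K)
qed

lemma reduced_form_quadratic:
  assumes "reduced_form g" and "vf_hom_part 2 g = quadratic_vf \<nu>"
  obtains h where "g = euler_vf h" and "\<And>i. mfps_nth (h i) 0 = 0"
    and "\<And>i j. mfps_nth (h i) (mi_unit j) = \<nu> $ i $ j"
proof -
  obtain h where h: "\<And>i. mfps_hom_part 0 (h i) = 0" "\<And>i. g $ i = mfps_X i * h i"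
    using assms(1) unfolding reduced_form_def by metis
  show ?thesis
  proof
    show "g = euler_vf h"
      by (simp add: h(2) euler_vf_def vec_eq_iff)
    show "mfps_nth (h i) 0 = 0" for i
      using arg_cong[OF h(1)[of i], of "\<lambda>u. mfps_nth u 0"] by (simp add: mfps_hom_part.rep_eq)
    show "mfps_nth (h i) (mi_unit j) = \<nu> $ i $ j" for i j
    proof -
      have "mfps_nth (vf_hom_part 2 g $ i) (mi_unit i + mi_unit j) = mfps_nth (h i) (mi_unit j)"
        by (simp add: vf_hom_part_def mfps_hom_part.rep_eq mi_degree_add h(2) mfps_X_single)
      moreover have "mfps_nth (quadratic_vf \<nu> $ i) (mi_unit i + mi_unit j) = \<nu> $ i $ j"
        unfolding quadratic_vf_def vec_lambda_beta mfps_X_single mfps_nth_single_mult_add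
        by (simp add: mfps_nth_single if_distrib cong: if_cong)
      ultimately show ?thesis
        using assms(2) by simp
    qed
  qed
qed

text \<open>In the degree after the order d of \<psi>, terms of g beyond the quadratic ones meet
  only coefficients below d, so the equations of the quadratic part hold. By
  \<open>lv_vanish_except\<close> a nonzero coefficient of degree d sits at an exceptional exponent,
  which fixes d = r + 1.\<close>

lemma lowest_degree_part:
  fixes \<psi> :: "'r::finite mfps"
  assumes gen: "lv_generic \<nu>" and "reduced_form g" and "vf_hom_part 2 g = quadratic_vf \<nu>"
    and "inv_jacobi_multiplier g \<psi>"
  shows "\<exists>j. mfps_nth \<psi> (1 + mi_unit j) \<noteq> 0"
    and "\<And>k. mi_degree k \<le> CARD('r) + 1 \<Longrightarrow> (\<And>j. k \<noteq> 1 + mi_unit j) \<Longrightarrow> mfps_nth \<psi> k = 0"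
    and "\<And>K. mi_degree K = CARD('r) + 2 \<Longrightarrow> lv_equation \<nu> (mfps_nth \<psi>) K"
proof -
  obtain h where h: "g = euler_vf h" "\<And>i. mfps_nth (h i) 0 = 0"
    "\<And>i j. mfps_nth (h i) (mi_unit j) = \<nu> $ i $ j"
    using assms(2,3) by (rule reduced_form_quadratic) blast
  define d where "d = (LEAST d. \<exists>k. mi_degree k = d \<and> mfps_nth \<psi> k \<noteq> 0)"
  obtain k0 where k0: "mfps_nth \<psi> k0 \<noteq> 0"
    using assms(4) by (metis inv_jacobi_multiplier_def mfps_eqI zero_mfps.rep_eq)
  then have "\<exists>d k. mi_degree k = d \<and> mfps_nth \<psi> k \<noteq> 0"
    by blast
  then have "\<exists>k. mi_degree k = d \<and> mfps_nth \<psi> k \<noteq> 0"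
    unfolding d_def by (rule LeastI_ex)
  then obtain k where k: "mi_degree k = d" "mfps_nth \<psi> k \<noteq> 0"
    by blast
  have low: "mfps_nth \<psi> l = 0" if "mi_degree l < d" for l
    using that not_less_Least[of "mi_degree l" "\<lambda>d. \<exists>k. mi_degree k = d \<and> mfps_nth \<psi> k \<noteq> 0"]
    unfolding d_def by blast
  have eqs: "lv_equation \<nu> (mfps_nth \<psi>) K" if K: "mi_degree K = Suc d" for K
  proof -
    have "mfps_nth \<psi> l = 0" if "l + p = K" "2 \<le> mi_degree p" for l p
      using low that K by (auto simp: mi_degree_add)
    then show ?thesis
      unfolding lv_equation_def
      using assms(4) sum_splits_degree_one[of h \<nu> K "mfps_nth \<psi>"] h
      by (simp add: inv_jacobi_multiplier_def multiplier_euler_vf_coeff)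
  qed
  have "\<exists>j. k = 1 + mi_unit j"
    using lv_vanish_except[OF gen eqs k(1)] k(2) by blast
  then obtain j where j: "k = 1 + mi_unit j"
    by blast
  then have d: "d = CARD('r) + 1"
    using k by (simp add: mi_degree_add)
  show "\<exists>j. mfps_nth \<psi> (1 + mi_unit j) \<noteq> 0"
    using j k by blast
  show "mfps_nth \<psi> l = 0" if "mi_degree l \<le> CARD('r) + 1" "\<And>j. l \<noteq> 1 + mi_unit j" for l
    using that lv_vanish_except[OF gen eqs, where k = l] low d by (cases "mi_degree l = d") auto
  show "lv_equation \<nu> (mfps_nth \<psi>) K" if "mi_degree K = CARD('r) + 2" for K
    using eqs that d by simp
qed

text \<open>Up to sign the determinant of the three equations from \<open>lv_pair\<close> for the
  exceptional coefficients belonging to x, y and z.\<close>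

definition lv_triple :: "complex ^ 'r ^ 'r \<Rightarrow> 'r \<Rightarrow> 'r \<Rightarrow> 'r::finite \<Rightarrow> complex" where
  "lv_triple \<nu> x y z =
    (\<nu> $ x $ z - \<nu> $ z $ z) * (\<nu> $ z $ y - \<nu> $ y $ y) * (\<nu> $ y $ x - \<nu> $ x $ x) +
    (\<nu> $ z $ x - \<nu> $ x $ x) * (\<nu> $ y $ z - \<nu> $ z $ z) * (\<nu> $ x $ y - \<nu> $ y $ y)"

lemma no_multiplier_of_triple:
  fixes x y z :: "'r::finite"
  assumes gen: "lv_generic \<nu>" and xyz: "x \<noteq> y" "x \<noteq> z" "y \<noteq> z" and triple: "lv_triple \<nu> x y z \<noteq> 0"
    and g: "reduced_form g" "vf_hom_part 2 g = quadratic_vf \<nu>"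
  shows "\<not> inv_jacobi_multiplier g \<psi>"
proof
  assume \<psi>: "inv_jacobi_multiplier g \<psi>"
  define u where "u i = mfps_nth \<psi> (1 + mi_unit i)" for i
  define c where "c i j = \<nu> $ i $ j - \<nu> $ j $ j" for i j
  have pair: "c j i * u j + c i j * u i = 0" if "i \<noteq> j" for i j
    using lv_pair[OF gen lowest_degree_part(3)[OF gen g \<psi>] that]
    by (simp add: u_def c_def lv_coeff_one_unit)
  have c: "c i j \<noteq> 0" if "i \<noteq> j" for i j
    using lv_genericD[OF gen that] by (simp add: c_def lv_coeff_one_unit)
  \<comment> \<open>Elimination of \<open>u y\<close> and \<open>u z\<close> from the three pair
    equations.\<close>
  have "lv_triple \<nu> x y z * u x * c z y = 0"
    using pair[OF xyz(1)] pair[OF xyz(2)] pair[OF xyz(3)]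
    unfolding lv_triple_def c_def[symmetric] by algebra
  then have "u x = 0"
    using triple c xyz by auto
  \<comment> \<open>The pair equation of x and j transports the vanishing to every variable.\<close>
  then have "u j = 0" for j
    using pair[of x j] c[of j x] by (cases "j = x") auto
  then show False
    using lowest_degree_part(1)[OF gen g \<psi>] by (simp add: u_def)
qed

section \<open>Null sets of parameters\<close>

lemma full_measure_negligible: "full_measure S \<longleftrightarrow> negligible (- S)"
  by (simp add: full_measure_def negligible_iff_null_sets)

text \<open>On a ray from a point with \<open>L a\<close> nonzero, L is affine and nonzero at the
  start, so it has at most one zero; \<open>starlike_negligible\<close> asks for exactly
  this.\<close>

lemma negligible_kernel:
  fixes L :: "'a::euclidean_space \<Rightarrow> complex"
  assumes L: "linear L" and "L a \<noteq> 0"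
  shows "negligible {v. L v = 0}"
proof (rule starlike_negligible)
  show "closed {v. L v = 0}"
    by (intro closed_Collect_eq continuous_intros linear_continuous_on)
      (simp add: L linear_linear)
  fix c x
  assume "a + c *\<^sub>R x \<in> {v. L v = 0}" "a + x \<in> {v. L v = 0}"
  then have "L a + c *\<^sub>R L x = 0" "L a + L x = 0"
    by (simp_all add: linear_add[OF L] linear_scale[OF L])
  then have "(c - 1) *\<^sub>R L x = 0" and "L x \<noteq> 0"
    using \<open>L a \<noteq> 0\<close> by (auto simp: scaleR_left_diff_distrib) (metis add_left_cancel)
  then show "c = 1"
    by simp
qed

lemma linear_lv_coeff: "linear (\<lambda>\<nu>. lv_coeff \<nu> j k)"
  by (rule linearI)
    (simp_all add: lv_coeff_def algebra_simps sum.distrib sum_subtractf scaleR_sum_right)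

text \<open>The multi-indices are countable, so it suffices that each condition excludes the kernel
  of a nonzero linear form.\<close>

lemma full_measure_lv_generic: "full_measure {\<nu> :: complex ^ 'r ^ 'r::finite. lv_generic \<nu>}"
proof -
  have "negligible {\<nu>. lv_coeff \<nu> j k = 0}" if k: "k \<noteq> 1 + mi_unit j" for j and k :: "'r \<Rightarrow> nat"
  proof -
    obtain i where i: "k i \<noteq> (1 + mi_unit j) i"
      using k by (meson ext)
    \<comment> \<open>The matrix unit at (i, j) isolates the difference of the i-th exponents of k
      and 1 + e_j.\<close>
    let ?\<nu> = "(\<chi> p q. if p = i \<and> q = j then 1 else 0) :: complex ^ 'r ^ 'r"
    have "lv_coeff ?\<nu> j k = of_nat (k i) - of_nat ((1 + mi_unit j) i)"
      unfolding lv_coeff_def by (simp add: if_distrib cong: if_cong)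
    then have "lv_coeff ?\<nu> j k \<noteq> 0"
      using i by (simp only: of_nat_eq_iff right_minus_eq not_False_eq_True)
    then show ?thesis
      by (rule negligible_kernel[OF linear_lv_coeff])
  qed
  then have "(\<Union>(j, k)\<in>{(j, k). k \<noteq> 1 + mi_unit j}. {\<nu> :: complex ^ 'r ^ 'r. lv_coeff \<nu> j k = 0}) \<in> null_sets lebesgue"
    by (intro null_sets_UN') (auto simp: negligible_iff_null_sets)
  moreover have "- {\<nu>. lv_generic \<nu>} =
      (\<Union>(j, k)\<in>{(j, k). k \<noteq> 1 + mi_unit j}. {\<nu> :: complex ^ 'r ^ 'r. lv_coeff \<nu> j k = 0})"
    by (auto simp: lv_generic_def)
  ultimately show ?thesis
    by (simp add: full_measure_def)
qed

text \<open>The zero set of this cubic is cut into closed pieces on which P is bounded away from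
  zero, and a ray argument handles each piece. P is a product of two generically nonzero forms, so
  every generic zero lies in some piece.\<close>

lemma full_measure_lv_triple:
  fixes x y z :: "'r::finite"
  assumes xyz: "x \<noteq> y" "x \<noteq> z" "y \<noteq> z"
  shows "full_measure {\<nu>. lv_generic \<nu> \<and> lv_triple \<nu> x y z \<noteq> 0}"
proof -
  define P :: "complex ^ 'r ^ 'r \<Rightarrow> complex"
    where "P \<nu> = (\<nu> $ z $ y - \<nu> $ y $ y) * (\<nu> $ y $ x - \<nu> $ x $ x)" for \<nu>
  define Z where "Z n = {\<nu>. lv_triple \<nu> x y z = 0 \<and> inverse (real (Suc n)) \<le> norm (P \<nu>)}" for n
  text \<open>Along rays from this base point \<open>lv_triple\<close> is \<open>t\<^sup>2\<close> times an affine function of \<open>t\<close> with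
    constant term \<open>P\<close>.\<close>
  define a :: "complex ^ 'r ^ 'r" where "a = axis x (axis z 1)"
  have "negligible (Z n)" for n
  proof (rule starlike_negligible[where a = a])
    show "closed (Z n)"
      unfolding Z_def P_def lv_triple_def
      by (intro closed_Collect_conj closed_Collect_eq closed_Collect_le continuous_intros)
    fix t :: real and w :: "complex ^ 'r ^ 'r"
    assume tw: "a + t *\<^sub>R w \<in> Z n" and w: "a + w \<in> Z n"
    have a: "a $ x $ z = 1" "a $ z $ z = 0" "a $ z $ y = 0" "a $ y $ y = 0" "a $ y $ x = 0"
      "a $ x $ x = 0" "a $ z $ x = 0" "a $ y $ z = 0" "a $ x $ y = 0"
      using xyz by (auto simp: a_def axis_def)
    define G where "G = lv_triple w x y z"
    define T where "T = complex_of_real t"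
    have tw_nth: "(t *\<^sub>R w) $ i $ j = complex_of_real t * w $ i $ j" for t i j
      by (simp add: scaleR_conv_of_real[of t "w $ i $ j"])
    have tri: "lv_triple (a + t *\<^sub>R w) x y z = T ^ 2 * (P w + T * G)"
      if "T = complex_of_real t" for t T
      unfolding lv_triple_def P_def G_def vector_add_component tw_nth a that
      by (simp add: power2_eq_square algebra_simps)
    have "P w + G = 0"
      using w tri[of 1 1] by (simp add: Z_def)
    moreover have "P (a + t *\<^sub>R w) = T ^ 2 * P w"
      unfolding P_def vector_add_component tw_nth a T_def
      by (simp add: power2_eq_square algebra_simps)
    then have "T \<noteq> 0" "P w \<noteq> 0"
      using tw by (auto simp: Z_def)
    moreover have "T ^ 2 * (P w + T * G) = 0"
      using tw tri[OF T_def] by (simp add: Z_def T_def)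
    \<comment> \<open>Both P w + G and P w + T G vanish while P w does not.\<close>
    ultimately have "T = 1"
      by (auto simp: add_eq_0_iff)
    then show "t = 1"
      by (simp add: T_def)
  qed
  then have "(\<Union>n. Z n) \<in> null_sets lebesgue"
    by (intro null_sets_UN) (auto simp: negligible_iff_null_sets)
  then have "negligible (- {\<nu> :: complex ^ 'r ^ 'r. lv_generic \<nu>} \<union> (\<Union>n. Z n))"
    using full_measure_lv_generic
    by (intro negligible_Un) (simp_all add: full_measure_negligible negligible_iff_null_sets)
  moreover have "- {\<nu>. lv_generic \<nu> \<and> lv_triple \<nu> x y z \<noteq> 0} \<subseteq> - {\<nu>. lv_generic \<nu>} \<union> (\<Union>n. Z n)"
  proof -
    have "\<nu> \<in> (\<Union>n. Z n)" if gen: "lv_generic \<nu>" and tri: "lv_triple \<nu> x y z = 0" for \<nu>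
    proof -
      have "P \<nu> \<noteq> 0"
        using lv_genericD[OF gen xyz(1)[symmetric]] lv_genericD[OF gen xyz(3)[symmetric]]
        by (simp add: P_def lv_coeff_one_unit)
      then obtain n where "inverse (real (Suc n)) < norm (P \<nu>)"
        using reals_Archimedean by (metis zero_less_norm_iff)
      then have "\<nu> \<in> Z n"
        using tri by (simp add: Z_def)
      then show ?thesis
        by blast
    qed
    then show ?thesis
      by blast
  qed
  ultimately have "negligible (- {\<nu>. lv_generic \<nu> \<and> lv_triple \<nu> x y z \<noteq> 0})"
    by (rule negligible_subset)
  then show ?thesis
    by (simp only: full_measure_negligible)
qed

section \<open>Quadratic and cubic reduced vector fields\<close>

lemma quadratic_vf_euler: "quadratic_vf \<nu> = euler_vf (\<lambda>i. \<Sum>j\<in>UNIV. mfps_const (\<nu> $ i $ j) * mfps_X j)"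
  by (simp add: quadratic_vf_def euler_vf_def)

lemma nth_linear_form:
  "mfps_nth (\<Sum>j\<in>UNIV. mfps_const (\<nu> $ i $ j) * mfps_X j) k =
    (\<Sum>j\<in>UNIV. if k = mi_unit j then \<nu> $ i $ j else 0)"
  by (auto simp: mfps_X_single mfps_nth_single intro!: sum.cong)

lemma nth_linear_form_other: "mi_degree k \<noteq> 1 \<Longrightarrow>
    mfps_nth (\<Sum>j\<in>UNIV. mfps_const (\<nu> $ i $ j) * mfps_X j) k = 0"
  unfolding nth_linear_form by (intro sum.neutral) auto

lemma reduced_form_quadratic_vf: "reduced_form (quadratic_vf \<nu>)"
proof -
  have "mfps_hom_part 0 (\<Sum>j\<in>UNIV. mfps_const (\<nu> $ i $ j) * mfps_X j) = 0" for i
    by (rule mfps_eqI, unfold mfps_hom_part.rep_eq) (auto simp only: nth_linear_form_other zero_mfps.rep_eq split: if_split)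
  then show ?thesis
    by (auto simp: reduced_form_def quadratic_vf_def)
qed

lemma vf_hom_part_quadratic_vf: "vf_hom_part 2 (quadratic_vf \<nu>) = quadratic_vf \<nu>"
proof -
  have "mfps_nth (quadratic_vf \<nu> $ i) k = 0" if k: "mi_degree k \<noteq> 2" for i k
  proof (cases "mi_unit i \<le> k")
    case True
    have "mi_degree (k - mi_unit i) \<noteq> 1"
      using k arg_cong[OF mi_le_split[OF True], of mi_degree] by (simp add: mi_degree_add)
    then show ?thesis
      unfolding quadratic_vf_def vec_lambda_beta mfps_X_single[of i] mfps_nth_single_mult
      using nth_linear_form_other[of "k - mi_unit i" \<nu> i] by (simp del: mfps_nth_sum)
  next
    case False
    then show ?thesis
      by (simp add: quadratic_vf_def mfps_X_single[of i] mfps_nth_single_mult)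
  qed
  then show ?thesis
    by (auto simp: vf_hom_part_def vec_eq_iff mfps_hom_part.rep_eq intro!: mfps_eqI)
qed

lemma multiplier_quadratic_vf_iff:
  fixes \<nu> :: "complex ^ 'r ^ 'r::finite"
  shows "lie_deriv (quadratic_vf \<nu>) \<psi> = vf_div (quadratic_vf \<nu>) * \<psi> \<longleftrightarrow> (\<forall>K. lv_equation \<nu> (mfps_nth \<psi>) K)"
  unfolding quadratic_vf_euler multiplier_euler_vf_coeff lv_equation_def
proof (intro iff_allI arg_cong2[where f = "(=)"] refl sum_splits_degree_one)
  show "mfps_nth (\<Sum>j\<in>UNIV. mfps_const (\<nu> $ i $ j) * mfps_X j) (mi_unit j) = \<nu> $ i $ j" for i j
    unfolding nth_linear_form by simp
  show "mfps_nth (\<Sum>j\<in>UNIV. mfps_const (\<nu> $ i $ j) * mfps_X j) 0 = 0" for i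
    by (rule nth_linear_form_other) (simp add: mi_degree_def)
  fix k p :: "'r \<Rightarrow> nat"
  assume "2 \<le> mi_degree p"
  then have "mi_degree p \<noteq> 1"
    by simp
  from nth_linear_form_other[OF this, of \<nu>] show "(\<Sum>i\<in>UNIV. (of_nat (k i) - 1 - of_nat (p i)) *
      mfps_nth (\<Sum>j\<in>UNIV. mfps_const (\<nu> $ i $ j) * mfps_X j) p) * mfps_nth \<psi> k = 0"
    by (simp del: mfps_nth_sum)
qed

lemma mi_unit_add_eq_iff: "mi_unit s + mi_unit t = mi_unit a + mi_unit b \<longleftrightarrow> Upair s t = Upair a b"
proof
  assume eq: "mi_unit s + mi_unit t = mi_unit a + mi_unit b"
  show "Upair s t = Upair a b"
  proof (cases "s = a")
    case False
    then have "t = a"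
      using fun_cong[OF eq, of a] by (simp split: if_splits)
    then show ?thesis
      using eq by (simp add: add.commute)
  qed (use eq in simp)
qed (auto simp: add.commute)

lemma nth_cubic_part:
  assumes "g = euler_vf h" and "vf_hom_part 3 g = cubic_vf c"
  shows "mfps_nth (h i) (mi_unit a + mi_unit b) = c $ i $ Upair a b"
proof -
  let ?k = "mi_unit i + (mi_unit a + mi_unit b)"
  have "mfps_nth (vf_hom_part 3 g $ i) ?k = mfps_nth (h i) (mi_unit a + mi_unit b)"
    by (simp add: vf_hom_part_def mfps_hom_part.rep_eq mi_degree_add assms(1) euler_vf_def mfps_X_single)
  moreover have "monom2 (Upair s t) = mfps_single (mi_unit s + mi_unit t)" for s t :: 'a
    by transfer (simp add: mfps_X_single mfps_single_mult)
  then have monom2: "mfps_nth (monom2 p) (mi_unit a + mi_unit b) = (if p = Upair a b then 1 else 0)" for p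
    by (cases p) (simp add: mfps_nth_single mi_unit_add_eq_iff eq_commute[of "Upair a b"])
  have "mfps_nth (cubic_vf c $ i) ?k = c $ i $ Upair a b"
    unfolding cubic_vf_def vec_lambda_beta mfps_X_single mfps_nth_single_mult_add
    by (simp add: monom2 if_distrib cong: if_cong)
  ultimately show ?thesis
    using assms(2) by simp
qed

section \<open>The case of two variables\<close>

locale two_variables =
  fixes x y :: "'r::finite"
  assumes UNIV_xy: "UNIV = {x, y}" and x_neq_y: "x \<noteq> y"
begin

lemma y_neq_x [simp]: "y \<noteq> x" "x \<noteq> y"
  using x_neq_y by auto

lemma all_xy: "(\<forall>z. P z) \<longleftrightarrow> P x \<and> P y"
  by (metis UNIV_I UNIV_xy insertE singletonD)

lemma sum_xy: "(\<Sum>z\<in>UNIV. F z) = F x + F y"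
  by (simp add: UNIV_xy)

lemma card_xy [simp]: "CARD('r) = 2"
  by (simp add: UNIV_xy)

definition idx :: "nat \<Rightarrow> nat \<Rightarrow> 'r \<Rightarrow> nat" where
  "idx i j = (\<lambda>_. 0)(x := i, y := j)"

lemma idx_apply [simp]: "idx i j x = i" "idx i j y = j"
  by (simp_all add: idx_def)

lemma eq_idx_iff: "k = idx i j \<longleftrightarrow> k x = i \<and> k y = j"
  by (simp add: fun_eq_iff all_xy)

lemma idx_eta [simp]: "idx (k x) (k y) = k"
  by (simp add: fun_eq_iff all_xy)

lemma one_unit_idx: "1 + mi_unit x = idx 2 1" "1 + mi_unit y = idx 1 2"
  by (simp_all add: eq_idx_iff)

lemma idx_units: "idx 0 0 = 0" "idx 1 0 = mi_unit x" "idx 0 1 = mi_unit y"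
  "idx 2 0 = mi_unit x + mi_unit x" "idx 1 1 = mi_unit x + mi_unit y" "idx 0 2 = mi_unit y + mi_unit y"
  by (simp_all add: fun_eq_iff all_xy)

lemma mi_degree_idx [simp]: "mi_degree (idx i j) = i + j"
  by (simp add: mi_degree_def sum_xy)

lemma sum_splits_idx:
  "(\<Sum>(k, p)\<in>{(k, p). k + p = idx A B}. F k p) =
    (\<Sum>i\<le>A. \<Sum>j\<le>B. F (idx i j) (idx (A - i) (B - j)))"
proof -
  have "(\<Sum>(k, p)\<in>{(k, p). k + p = idx A B}. F k p) =
      (\<Sum>(i, j)\<in>{..A} \<times> {..B}. F (idx i j) (idx (A - i) (B - j)))"
    by (rule sum.reindex_bij_witness[where j = "\<lambda>(k, p). (k x, k y)"
          and i = "\<lambda>(i, j). (idx i j, idx (A - i) (B - j))"])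
      (auto simp: fun_eq_iff all_xy)
  then show ?thesis
    by (simp add: sum.cartesian_product)
qed

text \<open>The two exceptional coefficients are chosen to solve the one equation that
  \<open>lv_pair\<close> imposes on them.\<close>

definition multiplier2 :: "complex ^ 'r ^ 'r \<Rightarrow> 'r mfps" where
  "multiplier2 \<nu> = mfps_const (lv_coeff \<nu> x (1 + mi_unit y)) * mfps_single (1 + mi_unit x) -
    mfps_const (lv_coeff \<nu> y (1 + mi_unit x)) * mfps_single (1 + mi_unit y)"

lemma nth_multiplier2:
  "mfps_nth (multiplier2 \<nu>) (1 + mi_unit x) = lv_coeff \<nu> x (1 + mi_unit y)"
  "mfps_nth (multiplier2 \<nu>) (1 + mi_unit y) = - lv_coeff \<nu> y (1 + mi_unit x)"
  "(\<And>j. k \<noteq> 1 + mi_unit j) \<Longrightarrow> mfps_nth (multiplier2 \<nu>) k = 0"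
  by (simp_all add: multiplier2_def mfps_nth_single)

lemma multiplier2:
  assumes gen: "lv_generic \<nu>"
  shows "inv_jacobi_multiplier (quadratic_vf \<nu>) (multiplier2 \<nu>)"
proof -
  let ?a = "mfps_nth (multiplier2 \<nu>)"
  have "lv_equation \<nu> ?a K" for K
  \<comment> \<open>At any other K an exceptional exponent is reached only by lowering its own
    variable, where \<open>lv_coeff\<close> is zero.\<close>
  proof (cases "K = 1 + mi_unit x + mi_unit y")
    case True
    have "{j. 0 < K j} = {x, y}" "K - mi_unit x = 1 + mi_unit y" "K - mi_unit y = 1 + mi_unit x"
      using UNIV_xy by (auto simp: True fun_eq_iff)
    then show ?thesis
      by (simp add: lv_equation_def nth_multiplier2)
  next
    case False
    have "lv_coeff \<nu> j (K - mi_unit j) * ?a (K - mi_unit j) = 0" if "0 < K j" for j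
    proof (cases "\<exists>i. K - mi_unit j = 1 + mi_unit i")
      case True
      then obtain i where i: "K - mi_unit j = 1 + mi_unit i"
        by blast
      then have "K = 1 + mi_unit i + mi_unit j"
        using mi_unit_split[of K j] that by (simp add: add.commute)
      then have "i = j"
        using False UNIV_I[of i] UNIV_I[of j] unfolding UNIV_xy by (auto simp: ac_simps)
      then show ?thesis
        by (simp add: i lv_coeff_one_unit)
    next
      case False
      then have "?a (K - mi_unit j) = 0"
        by (intro nth_multiplier2(3)) simp
      then show ?thesis
        by simp
    qed
    then show ?thesis
      unfolding lv_equation_def by (intro sum.neutral) blast
  qed
  moreover have "multiplier2 \<nu> \<noteq> 0"
    using nth_multiplier2(1)[of \<nu>] lv_genericD[OF gen y_neq_x(1)] by auto
  ultimately show ?thesis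
    by (simp add: inv_jacobi_multiplier_def multiplier_quadratic_vf_iff)
qed

lemma lowest_proportional:
  assumes gen: "lv_generic \<nu>" and eqs: "\<And>K. mi_degree K = 4 \<Longrightarrow> lv_equation \<nu> a K"
  obtains t where "\<And>j. a (1 + mi_unit j) = t * mfps_nth (multiplier2 \<nu>) (1 + mi_unit j)"
proof -
  define t where "t = a (1 + mi_unit x) / lv_coeff \<nu> x (1 + mi_unit y)"
  have nz: "lv_coeff \<nu> x (1 + mi_unit y) \<noteq> 0"
    using lv_genericD[OF gen y_neq_x(1)] .
  have "lv_coeff \<nu> x (1 + mi_unit y) * a (1 + mi_unit y) +
      lv_coeff \<nu> y (1 + mi_unit x) * a (1 + mi_unit x) = 0"
    using lv_pair[OF gen, of a x y] eqs by simp
  then have "a (1 + mi_unit y) = t * - lv_coeff \<nu> y (1 + mi_unit x)"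
    using nz by (simp add: t_def field_simps eq_neg_iff_add_eq_0)
  moreover have "a (1 + mi_unit x) = t * lv_coeff \<nu> x (1 + mi_unit y)"
    using nz by (simp add: t_def)
  ultimately have "\<forall>j. a (1 + mi_unit j) = t * mfps_nth (multiplier2 \<nu>) (1 + mi_unit j)"
    unfolding all_xy nth_multiplier2 by blast
  then show ?thesis
    using that by blast
qed

text \<open>The exceptional coefficients lie on a line by \<open>lowest_proportional\<close>; all
  others vanish by \<open>lv_vanish_except\<close>.\<close>

lemma multiplier2_unique:
  assumes gen: "lv_generic \<nu>" and \<psi>: "inv_jacobi_multiplier (quadratic_vf \<nu>) \<psi>"
  shows "\<exists>c. \<psi> = mfps_const c * multiplier2 \<nu>"
proof -
  have eqs: "lv_equation \<nu> (mfps_nth \<psi>) K" for K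
    using \<psi> by (simp add: inv_jacobi_multiplier_def multiplier_quadratic_vf_iff)
  obtain t where t: "mfps_nth \<psi> (1 + mi_unit j) = t * mfps_nth (multiplier2 \<nu>) (1 + mi_unit j)" for j
    using lowest_proportional[OF gen eqs] by blast
  have "\<psi> = mfps_const t * multiplier2 \<nu>"
  proof (rule mfps_eqI)
    fix k
    show "mfps_nth \<psi> k = mfps_nth (mfps_const t * multiplier2 \<nu>) k"
    proof (cases "\<exists>j. k = 1 + mi_unit j")
      case False
      then show ?thesis
        using lv_vanish_except[OF gen eqs refl, of k] by (simp add: nth_multiplier2(3))
    qed (auto simp: t)
  qed
  then show ?thesis
    by blast
qed

text \<open>The quadratic part maps the series of degree 4 to a proper subspace of the series of degree 5.
  The weights \<open>w41\<close>, \<open>w32 = 1\<close>, \<open>w23\<close>, \<open>w14\<close> give a linear functional annihilating that subspace;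
  \<open>obstruction\<close> is its value on the contribution of the cubic part and \<open>multiplier2 \<nu>\<close>.\<close>

definition obstruction :: "complex ^ 'r ^ 'r \<Rightarrow> complex ^ 'r uprod ^ 'r \<Rightarrow> complex" where
  "obstruction \<nu> c =
    (let xx = Upair x x; xy = Upair x y; yy = Upair y y;
         u = mfps_nth (multiplier2 \<nu>) (idx 2 1); v = mfps_nth (multiplier2 \<nu>) (idx 1 2);
         w41 = - (lv_coeff \<nu> y (idx 3 1) / lv_coeff \<nu> x (idx 3 1));
         w23 = - (lv_coeff \<nu> x (idx 2 2) / lv_coeff \<nu> y (idx 2 2));
         w14 = - (w23 * lv_coeff \<nu> x (idx 1 3) / lv_coeff \<nu> y (idx 1 3))
     in w41 * (- u * c $ x $ xx) + (- u * c $ y $ xy + v * (c $ y $ xx - 2 * c $ x $ xx)) +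
        w23 * (- v * c $ x $ xy + u * (c $ x $ yy - 2 * c $ y $ yy)) + w14 * (- v * c $ y $ yy))"

lemma full_measure_obstruction:
  assumes gen: "lv_generic \<nu>"
  shows "full_measure {c. obstruction \<nu> c \<noteq> 0}"
proof -
  \<comment> \<open>This coefficient enters \<open>obstruction\<close> only in the equation of
    weight 1, so the value is minus the first coefficient of \<open>multiplier2\<close>, whatever
    the other weights are.\<close>
  let ?c = "axis y (axis (Upair x y) 1) :: complex ^ 'r uprod ^ 'r"
  have "linear (obstruction \<nu>)"
    by (rule linearI) (simp_all add: obstruction_def Let_def algebra_simps scaleR_conv_of_real[of _ "_ :: complex"])
  moreover have "obstruction \<nu> ?c = - lv_coeff \<nu> x (1 + mi_unit y)"
    using nth_multiplier2(1)[of \<nu>] by (simp add: obstruction_def Let_def axis_def one_unit_idx)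
  then have "obstruction \<nu> ?c \<noteq> 0"
    using lv_genericD[OF gen y_neq_x(1)] by simp
  ultimately have "negligible {c. obstruction \<nu> c = 0}"
    by (rule negligible_kernel)
  moreover have "- {c. obstruction \<nu> c \<noteq> 0} = {c. obstruction \<nu> c = 0}"
    by auto
  ultimately show ?thesis
    by (simp add: full_measure_negligible)
qed

text \<open>The lowest part is t times \<open>multiplier2\<close> with t nonzero. Four equations of
  degree 5 then constrain three unknown coefficients of degree 4, and the weights of
  \<open>obstruction\<close> eliminate the unknowns.\<close>

lemma no_multiplier_of_obstruction:
  assumes gen: "lv_generic \<nu>" and obs: "obstruction \<nu> c \<noteq> 0"
    and g: "reduced_form g" "vf_hom_part 2 g = quadratic_vf \<nu>" and g3: "vf_hom_part 3 g = cubic_vf c"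
  shows "\<not> inv_jacobi_multiplier g \<psi>"
proof
  assume \<psi>: "inv_jacobi_multiplier g \<psi>"
  obtain h where h: "g = euler_vf h" "\<And>i. mfps_nth (h i) 0 = 0"
    "\<And>i j. mfps_nth (h i) (mi_unit j) = \<nu> $ i $ j"
    using g by (rule reduced_form_quadratic) blast
  note low = lowest_degree_part[OF gen g \<psi>]
  define a where "a i j = mfps_nth \<psi> (idx i j)" for i j
  define H where "H z i j = mfps_nth (h z) (idx i j)" for z i j
  have H: "H z 0 0 = 0" "H z 1 0 = \<nu> $ z $ x" "H z 0 1 = \<nu> $ z $ y"
    "H z 2 0 = c $ z $ Upair x x" "H z 1 1 = c $ z $ Upair x y" "H z 0 2 = c $ z $ Upair y y" for z
    unfolding H_def idx_units using h nth_cubic_part[OF h(1) g3] by simp_all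
  have a0: "a i j = 0" if "i + j \<le> 3" "(i, j) \<noteq> (2, 1)" "(i, j) \<noteq> (1, 2)" for i j
  proof -
    have "\<forall>l. idx i j \<noteq> 1 + mi_unit l"
      using that by (simp add: all_xy one_unit_idx eq_idx_iff)
    then show ?thesis
      unfolding a_def using low(2)[of "idx i j"] that by simp
  qed
  obtain t where t: "\<And>j. mfps_nth \<psi> (1 + mi_unit j) = t * mfps_nth (multiplier2 \<nu>) (1 + mi_unit j)"
    using lowest_proportional[OF gen, of "mfps_nth \<psi>"] low(3) by auto
  then have "t \<noteq> 0"
    using low(1) by auto
  define u where "u = mfps_nth (multiplier2 \<nu>) (idx 2 1)"
  define v where "v = mfps_nth (multiplier2 \<nu>) (idx 1 2)"
  have uv: "a 2 1 = t * u" "a 1 2 = t * v"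
    using t[of x] t[of y] by (simp_all add: one_unit_idx a_def u_def v_def)
  define F where "F A B i j = ((of_nat i - 1 - of_nat (A - i)) * H x (A - i) (B - j) +
      (of_nat j - 1 - of_nat (B - j)) * H y (A - i) (B - j)) * a i j" for A B i j
  have E: "(\<Sum>i\<le>A. \<Sum>j\<le>B. F A B i j) = 0" for A B
    using \<psi> unfolding inv_jacobi_multiplier_def h(1) multiplier_euler_vf_coeff
    by (auto simp: sum_splits_idx sum_xy F_def H_def a_def dest!: spec[of _ "idx A B"])
  define L where "L z i j = lv_coeff \<nu> z (idx i j)" for z i j
  have L: "L x i j = (of_nat i - 1) * \<nu> $ x $ x + (of_nat j - 1) * \<nu> $ y $ x - \<nu> $ x $ x"
    "L y i j = (of_nat i - 1) * \<nu> $ x $ y + (of_nat j - 1) * \<nu> $ y $ y - \<nu> $ y $ y" for i j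
    by (simp_all add: L_def lv_coeff_def sum_xy)
  have Lx: "L x i j \<noteq> 0" if "(i, j) \<noteq> (2, 1)" for i j
    using gen that unfolding L_def lv_generic_def by (metis eq_idx_iff one_unit_idx(1) idx_apply)
  have Ly: "L y i j \<noteq> 0" if "(i, j) \<noteq> (1, 2)" for i j
    using gen that unfolding L_def lv_generic_def by (metis eq_idx_iff one_unit_idx(2) idx_apply)
  have le_one: "{..1} = {0, 1 :: nat}" "{..0} = {0 :: nat}"
    by auto
  note expand = atMost_nat_numeral le_one le_one[unfolded One_nat_def] F_def H H[unfolded One_nat_def] a0 L
  \<comment> \<open>The equations at the pure powers x^5 and y^5 involve a single unknown
    each.\<close>
  have "L x 4 0 * a 4 0 = 0"
    using E[of 5 0] by (simp add: expand)
  then have a40: "a 4 0 = 0"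
    using Lx by simp
  have "L y 0 4 * a 0 4 = 0"
    using E[of 0 5] by (simp add: expand)
  then have a04: "a 0 4 = 0"
    using Ly by simp
  have E41: "L x 3 1 * a 3 1 - c $ x $ Upair x x * a 2 1 = 0"
    using E[of 4 1] by (simp add: expand a40)
  have E32: "L x 2 2 * a 2 2 + L y 3 1 * a 3 1 - c $ y $ Upair x y * a 2 1 +
      (c $ y $ Upair x x - 2 * c $ x $ Upair x x) * a 1 2 = 0"
    using E[of 3 2] by (simp add: expand algebra_simps)
  have E23: "L x 1 3 * a 1 3 + L y 2 2 * a 2 2 - c $ x $ Upair x y * a 1 2 +
      (c $ x $ Upair y y - 2 * c $ y $ Upair y y) * a 2 1 = 0"
    using E[of 2 3] by (simp add: expand algebra_simps)
  have E14: "L y 1 3 * a 1 3 - c $ y $ Upair y y * a 1 2 = 0"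
    using E[of 1 4] by (simp add: expand a04)
  \<comment> \<open>In the weighted sum w41 removes \<open>a 3 1\<close>, w23 removes
    \<open>a 2 2\<close>, and w14 removes \<open>a 1 3\<close>.\<close>
  define w41 where "w41 = - (L y 3 1 / L x 3 1)"
  define w23 where "w23 = - (L x 2 2 / L y 2 2)"
  define w14 where "w14 = - (w23 * L x 1 3 / L y 1 3)"
  have w: "w41 * L x 3 1 = - L y 3 1" "w23 * L y 2 2 = - L x 2 2" "w14 * L y 1 3 = - (w23 * L x 1 3)"
    using Lx[of 3 1] Ly[of 2 2] Ly[of 1 3] by (simp_all add: w41_def w23_def w14_def)
  have "obstruction \<nu> c = w41 * (- u * c $ x $ Upair x x) +
      (- u * c $ y $ Upair x y + v * (c $ y $ Upair x x - 2 * c $ x $ Upair x x)) +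
      w23 * (- v * c $ x $ Upair x y + u * (c $ x $ Upair y y - 2 * c $ y $ Upair y y)) +
      w14 * (- v * c $ y $ Upair y y)"
    unfolding obstruction_def Let_def w14_def w23_def w41_def u_def v_def L_def ..
  then have "t * obstruction \<nu> c = 0"
    using E41 E32 E23 E14 w unfolding uv by algebra
  then show False
    using \<open>t \<noteq> 0\<close> obs by simp
qed

end

section \<open>The full measure statements and the conclusion\<close>

lemma no_multiplier_full_measure:
  assumes "3 \<le> CARD('r::finite)"
  shows "\<exists>N :: (complex ^ 'r ^ 'r) set. full_measure N \<and>
    (\<forall>\<nu>\<in>N. \<forall>g \<psi>. reduced_form g \<and> vf_hom_part 2 g = quadratic_vf \<nu> \<longrightarrow> \<not> inv_jacobi_multiplier g \<psi>)"
proof -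
  obtain T :: "'r set" where "card T = 3"
    using assms by (rule obtain_subset_with_card_n)
  then obtain x y z :: 'r where xyz: "x \<noteq> y" "x \<noteq> z" "y \<noteq> z"
    by (auto simp: card_3_iff)
  then show ?thesis
    using full_measure_lv_triple[OF xyz] no_multiplier_of_triple[OF _ xyz]
    by (intro exI[of _ "{\<nu>. lv_generic \<nu> \<and> lv_triple \<nu> x y z \<noteq> 0}"]) blast
qed

lemma unique_multiplier_full_measure:
  assumes "CARD('r::finite) = 2"
  shows "\<exists>N :: (complex ^ 'r ^ 'r) set. full_measure N \<and>
    (\<forall>\<nu>\<in>N.
      (\<exists>\<psi>. inv_jacobi_multiplier (quadratic_vf \<nu>) \<psi> \<and>
        (\<forall>\<psi>'. inv_jacobi_multiplier (quadratic_vf \<nu>) \<psi>' \<longrightarrow> (\<exists>c. \<psi>' = mfps_const c * \<psi>))) \<and>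
      (\<exists>M :: (complex ^ 'r uprod ^ 'r) set. full_measure M \<and>
        (\<forall>c\<in>M. \<forall>g. reduced_form g \<and> vf_hom_part 2 g = quadratic_vf \<nu> \<and> vf_hom_part 3 g = cubic_vf c \<longrightarrow>
          \<not> (\<exists>\<psi>. inv_jacobi_multiplier g \<psi>))))"
proof -
  obtain x y :: 'r where "UNIV = {x, y}" "x \<noteq> y"
    using assms by (auto simp: card_2_iff)
  then interpret two_variables x y
    by unfold_locales
  show ?thesis
  proof (intro exI[of _ "{\<nu>. lv_generic \<nu>}"] conjI ballI full_measure_lv_generic)
    fix \<nu> :: "complex ^ 'r ^ 'r"
    assume "\<nu> \<in> {\<nu>. lv_generic \<nu>}"
    then have gen: "lv_generic \<nu>"
      by simp
    show "\<exists>\<psi>. inv_jacobi_multiplier (quadratic_vf \<nu>) \<psi> \<and>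
        (\<forall>\<psi>'. inv_jacobi_multiplier (quadratic_vf \<nu>) \<psi>' \<longrightarrow> (\<exists>c. \<psi>' = mfps_const c * \<psi>))"
      using multiplier2[OF gen] multiplier2_unique[OF gen] by blast
    show "\<exists>M :: (complex ^ 'r uprod ^ 'r) set. full_measure M \<and>
        (\<forall>c\<in>M. \<forall>g. reduced_form g \<and> vf_hom_part 2 g = quadratic_vf \<nu> \<and> vf_hom_part 3 g = cubic_vf c \<longrightarrow>
          \<not> (\<exists>\<psi>. inv_jacobi_multiplier g \<psi>))"
      using full_measure_obstruction[OF gen] no_multiplier_of_obstruction[OF gen]
      by (intro exI[of _ "{c. obstruction \<nu> c \<noteq> 0}"]) blast
  qed
qed

theorem theorem7:
  shows
    "(\<forall>(A :: complex ^ 'n ^ 'n) (f :: 'n vfield) (lam :: complex ^ 'n)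
        (\<phi> :: 'r::finite \<Rightarrow> 'n::finite mfps) (m :: 'r \<Rightarrow> 'n \<Rightarrow> nat).
        reducible_normal_form A f lam \<phi> m \<longrightarrow>
        (\<exists>(\<eta> :: 'n \<Rightarrow> 'n mfps) (\<eta>hat :: 'n \<Rightarrow> 'r mfps).
            (\<forall>j. \<eta> j = mfps_subst (\<eta>hat j) \<phi>) \<and>
            f = linear_vf A + (\<Sum>j\<in>UNIV. \<eta> j *s Q_vf j) \<and>
            (\<forall>fhat :: 'r vfield. reduced_vf f \<phi> fhat \<longleftrightarrow>
               fhat = (\<chi> i. mfps_X i * (\<Sum>j\<in>UNIV. of_nat (m i j) * \<eta>hat j)))) \<and>
        (\<forall>fhat :: 'r vfield. reduced_vf f \<phi> fhat \<longrightarrow> reduced_form fhat) \<and>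
        (\<forall>\<psi>. inv_jacobi_multiplier f \<psi> \<longrightarrow>
            (\<exists>\<rho>hat :: 'r mfps. \<psi> = (\<Prod>j\<in>UNIV. mfps_X j) * mfps_subst \<rho>hat \<phi>) \<and>
            (\<forall>(\<rho>hat :: 'r mfps) (fhat :: 'r vfield).
               \<psi> = (\<Prod>j\<in>UNIV. mfps_X j) * mfps_subst \<rho>hat \<phi> \<longrightarrow>
               reduced_vf f \<phi> fhat \<longrightarrow>
               inv_jacobi_multiplier fhat ((\<Prod>i\<in>UNIV. mfps_X i) * \<rho>hat)))) \<and>
     (CARD('r) \<ge> 3 \<longrightarrow>
        (\<exists>N :: (complex ^ 'r ^ 'r) set. full_measure N \<and>
          (\<forall>\<nu>\<in>N.
            \<not> (\<exists>\<psi>. inv_jacobi_multiplier (quadratic_vf \<nu>) \<psi>) \<and>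
            (\<forall>g :: 'r vfield. reduced_form g \<and> vf_hom_part 2 g = quadratic_vf \<nu> \<longrightarrow>
               \<not> (\<exists>\<psi>. inv_jacobi_multiplier g \<psi>))))) \<and>
     (CARD('r) = 2 \<longrightarrow>
        (\<exists>N :: (complex ^ 'r ^ 'r) set. full_measure N \<and>
          (\<forall>\<nu>\<in>N.
            (\<exists>\<psi>. inv_jacobi_multiplier (quadratic_vf \<nu>) \<psi> \<and>
               (\<forall>\<psi>'. inv_jacobi_multiplier (quadratic_vf \<nu>) \<psi>' \<longrightarrow>
                  (\<exists>c. \<psi>' = mfps_const c * \<psi>))) \<and>
            (\<exists>M :: (complex ^ 'r uprod ^ 'r) set. full_measure M \<and>
               (\<forall>c\<in>M. \<forall>g :: 'r vfield.
                  reduced_form g \<and> vf_hom_part 2 g = quadratic_vf \<nu> \<and>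
                  vf_hom_part 3 g = cubic_vf c \<longrightarrow>
                  \<not> (\<exists>\<psi>. inv_jacobi_multiplier g \<psi>))))))"
proof (intro conjI allI impI, goal_cases)
  case (1 A f lam \<phi> m)
  then show ?case
    by (rule reducible_normal_form.reduction)
next
  case (2 A f lam \<phi> m fhat)
  then show ?case
    by (rule reducible_normal_form.reduction_form)
next
  case (3 A f lam \<phi> m \<psi>)
  then show ?case
    by (rule reducible_normal_form.multiplier_form)
next
  case (4 A f lam \<phi> m \<psi> \<rho>hat fhat)
  then show ?case
    using reducible_normal_form.reduction_multiplier by blast
next
  \<comment> \<open>The quadratic field is itself an admissible g, so both claims come from the same
    set.\<close>
  case 5
  then show ?case
    using no_multiplier_full_measure reduced_form_quadratic_vf vf_hom_part_quadratic_vf by metis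
next
  case 6
  then show ?case
    by (rule unique_multiplier_full_measure)
qed

end
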